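(* Let $s\subseteq[n]$ and let $|\psi\rangle,|\phi\rangle$ be $n$-qubit pure states. For $X\in\mathcal{P}(s)$ let $r_X=\min(\dim\mathcal{H}_X,\dim\mathcal{H}_{X^c})$ and set $\epsilon_{\max}=\max_{X\in\mathcal{P}(s)}\max_{0\le j<r_X}(\epsilon^X_j+\epsilon^{X^c}_j)$, assumed $>0$. (1) (Continuity) For every $\epsilon>0$, if $D(\psi,\phi):=\tfrac12\||\psi\rangle\langle\psi|-|\phi\rangle\langle\phi|\|_1\le \frac{\epsilon}{2\epsilon_{\max}}$, then $|M^{(s)}_E(|\psi\rangle)-M^{(s)}_E(|\phi\rangle)|\le\epsilon$. (2) (Majorization monotonicity) If for every $X\in\mathcal{P}(s)$ the spectrum of the marginal $\rho_X^{\psi}=\mathrm{tr}_{X^c}|\psi\rangle\langle\psi|$ is majorized by that of $\rho_X^{\phi}=\mathrm{tr}_{X^c}|\phi\rangle\langle\phi|$, i.e. $\lambda(\rho^\psi_X)\prec\lambda(\rho^\phi_X)$, then $M^{(s)}_E(|\psi\rangle)\ge M^{(s)}_E(|\phi\rangle)$.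
   Context: Each subsystem $X$ (and $X^c$) carries a Hamiltonian $H_X=\sum_j\epsilon^X_j|\epsilon^X_j\rangle\langle\epsilon^X_j|$ with $0=\epsilon^X_0\le\epsilon^X_1\le\cdots$. For a state $\rho_X$ with eigenvalues $p_0\ge p_1\ge\cdots$, its passive state is $\rho^p_X=\sum_jp_j|\epsilon^X_j\rangle\langle\epsilon^X_j|$. For a pure state $|\psi\rangle$, $\Delta_{X|X^c}(|\psi\rangle)=\mathrm{tr}(\rho_X^pH_X)+\mathrm{tr}(\rho_{X^c}^pH_{X^c})$, set to $0$ if $X=\emptyset$ or $X=[n]$; $\mathcal{P}(s)$ is the power set of $s$ and $M^{(s)}_E(|\psi\rangle)=2^{-|s|}\sum_{X\in\mathcal{P}(s)}\Delta_{X|X^c}(|\psi\rangle)$. Majorization: for probability vectors $p,q\in\mathbb{R}^m$ sorted nonincreasingly (padding with zeros), $p\prec q$ means $\sum_{i=1}^kp_i^\downarrow\le\sum_{i=1}^kq_i^\downarrow$ for all $1\le k\le m-1$ and $\sum_ip_i=\sum_iq_i$. *)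

theory Defs
  imports Complex_Main "Jordan_Normal_Form.Schur_Decomposition"
begin

text \<open>An n-qubit pure state is a complex vector of dimension 2^n; the computational basis
index i < 2^n encodes qubit k (for k < n) in bit k of i. For a subsystem X (a subset of
{0..<n}), local basis index a < 2^(card X) encodes the state of the k-th smallest qubit of X
in bit k of a.\<close>

definition embed_idx :: "nat set \<Rightarrow> nat \<Rightarrow> nat" where
  "embed_idx X a = (\<Sum>k<card X. if bit a k then 2 ^ (sorted_list_of_set X ! k) else 0)"

definition qstate :: "nat \<Rightarrow> complex vec \<Rightarrow> bool" where
  "qstate n \<psi> \<longleftrightarrow> \<psi> \<in> carrier_vec (2 ^ n) \<and> (\<Sum>i<2 ^ n. (cmod (\<psi> $ i))\<^sup>2) = 1"

definition reduced_dm :: "nat \<Rightarrow> nat set \<Rightarrow> complex vec \<Rightarrow> complex mat" where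
  "reduced_dm n X \<psi> = mat (2 ^ card X) (2 ^ card X) (\<lambda>(a, a').
     \<Sum>c<2 ^ card ({0..<n} - X).
        \<psi> $ (embed_idx X a + embed_idx ({0..<n} - X) c)
        * cnj (\<psi> $ (embed_idx X a' + embed_idx ({0..<n} - X) c)))"

definition proj :: "complex vec \<Rightarrow> complex mat" where
  "proj \<psi> = mat (dim_vec \<psi>) (dim_vec \<psi>) (\<lambda>(i, j). \<psi> $ i * cnj (\<psi> $ j))"

definition spec_desc :: "complex mat \<Rightarrow> real list" where
  "spec_desc A = (SOME l. length l = dim_row A \<and> sorted_wrt (\<ge>) l \<and>
      char_poly A = (\<Prod>x\<leftarrow>l. [:- complex_of_real x, 1:]))"

definition trace_norm :: "complex mat \<Rightarrow> real" where
  "trace_norm A = sum_list (map sqrt (spec_desc (mat_adjoint A * A)))"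

definition trace_dist :: "complex vec \<Rightarrow> complex vec \<Rightarrow> real" where
  "trace_dist \<psi> \<phi> = trace_norm (proj \<psi> - proj \<phi>) / 2"

text \<open>eps X j is the j-th energy level eps^X_j of the Hamiltonian H_X of subsystem X
(levels j < 2^card X, listed nondecreasingly, eps X 0 = 0). Since the passive state of
rho_X is sum_j p_j |eps^X_j><eps^X_j| with p nonincreasing, tr(rho^p_X H_X) = sum_j p_j eps^X_j.\<close>
definition hamiltonian_levels :: "nat \<Rightarrow> (nat set \<Rightarrow> nat \<Rightarrow> real) \<Rightarrow> bool" where
  "hamiltonian_levels n eps \<longleftrightarrow> (\<forall>X. X \<subseteq> {0..<n} \<longrightarrow>
      eps X 0 = 0 \<and> (\<forall>i j. i \<le> j \<longrightarrow> j < 2 ^ card X \<longrightarrow> eps X i \<le> eps X j))"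

definition passive_energy :: "nat \<Rightarrow> (nat set \<Rightarrow> nat \<Rightarrow> real) \<Rightarrow> nat set \<Rightarrow> complex vec \<Rightarrow> real" where
  "passive_energy n eps X \<psi> =
     (\<Sum>j<2 ^ card X. spec_desc (reduced_dm n X \<psi>) ! j * eps X j)"

definition Delta :: "nat \<Rightarrow> (nat set \<Rightarrow> nat \<Rightarrow> real) \<Rightarrow> nat set \<Rightarrow> complex vec \<Rightarrow> real" where
  "Delta n eps X \<psi> = (if X = {} \<or> X = {0..<n} then 0
      else passive_energy n eps X \<psi> + passive_energy n eps ({0..<n} - X) \<psi>)"

definition ME :: "nat \<Rightarrow> (nat set \<Rightarrow> nat \<Rightarrow> real) \<Rightarrow> nat set \<Rightarrow> complex vec \<Rightarrow> real" where
  "ME n eps s \<psi> = (\<Sum>X\<in>Pow s. Delta n eps X \<psi>) / 2 ^ card s"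

definition eps_max :: "nat \<Rightarrow> (nat set \<Rightarrow> nat \<Rightarrow> real) \<Rightarrow> nat set \<Rightarrow> real" where
  "eps_max n eps s = Max (\<Union>X\<in>Pow s.
      (\<lambda>j. eps X j + eps ({0..<n} - X) j) ` {..<min (2 ^ card X) (2 ^ card ({0..<n} - X))})"

definition pad :: "nat \<Rightarrow> real list \<Rightarrow> real list" where
  "pad m l = l @ replicate (m - length l) 0"

definition desc :: "real list \<Rightarrow> real list" where
  "desc l = rev (sort l)"

definition majorized :: "real list \<Rightarrow> real list \<Rightarrow> bool" where
  "majorized p q \<longleftrightarrow> (let m = max (length p) (length q) in
     (\<forall>k. 1 \<le> k \<and> k \<le> m - 1 \<longrightarrow>
        sum_list (take k (desc (pad m p))) \<le> sum_list (take k (desc (pad m q))))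
     \<and> sum_list p = sum_list q)"

end

theory Submission
  imports Defs "HOL-Library.Nat_Bijection"
begin

text \<open>Writing the amplitudes of \<open>\<psi>\<close> as a matrix \<open>M\<close> indexed by the basis states of \<open>X\<close> and of its
complement, the two marginals are \<open>M M\<^sup>*\<close> and the transpose of \<open>M\<^sup>* M\<close>, so they have the same
spectrum \<open>p\<close> up to zeros. Hence the contribution of \<open>X\<close> is \<open>\<Sum>j<r. p j * g j\<close> with
\<open>g j = \<epsilon>\<^sup>X j + \<epsilon>\<^sup>Y j\<close> nondecreasing from \<open>g 0 = 0\<close>. As the \<open>p j\<close> sum to 1, Abel summation expresses
the difference of the contributions of \<open>\<psi>\<close> and \<open>\<phi>\<close> through the differences of the partial sums of the spectra,
with coefficients \<open>-(g (k+1) - g k) \<le> 0\<close>. Majorization fixes the sign of these differences, which gives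
monotonicity. By Ky Fan's principle the partial sums are maxima of \<open>tr (P \<rho>\<^sub>X) = tr ((P \<otimes> 1) |\<psi>\<rangle>\<langle>\<psi>|)\<close>
over projections \<open>P\<close> of rank \<open>k\<close>, so their difference is at most the trace norm of
\<open>|\<psi>\<rangle>\<langle>\<psi>| - |\<phi>\<rangle>\<langle>\<phi>|\<close>, which gives continuity; the sharper bound by half of the trace norm is not
needed because of the factor 2 in the hypothesis.\<close>

section \<open>The spectral theorem for Hermitian matrices\<close>

lemma mat_adjoint_eq_mat:
  "mat_adjoint A = mat (dim_col A) (dim_row A) (\<lambda>(i, j). conjugate (A $$ (j, i)))"
  by (rule eq_matI) (auto simp: mat_adjoint_def mat_of_rows_def)

lemma mat_adjoint_carrier:
  "A \<in> carrier_mat n m \<Longrightarrow> mat_adjoint A \<in> carrier_mat m n"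
  by (auto simp: mat_adjoint_eq_mat)

lemma index_mat_adjoint:
  assumes "A \<in> carrier_mat n m" "i < m" "j < n"
  shows "mat_adjoint A $$ (i, j) = conjugate (A $$ (j, i))"
  using assms by (auto simp: mat_adjoint_eq_mat)

lemma index_mult_mat_sum:
  assumes "A \<in> carrier_mat n m" "B \<in> carrier_mat m k" "i < n" "j < k"
  shows "(A * B) $$ (i, j) = (\<Sum>l<m. A $$ (i, l) * B $$ (l, j))"
  using assms by (auto simp: scalar_prod_def lessThan_atLeast0)

lemma mat_adjoint_mult:
  fixes A :: "complex mat"
  assumes A: "A \<in> carrier_mat n m" and B: "B \<in> carrier_mat m k"
  shows "mat_adjoint (A * B) = mat_adjoint B * mat_adjoint A"
proof (rule eq_matI)
  fix i j assume "i < dim_row (mat_adjoint B * mat_adjoint A)"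
    "j < dim_col (mat_adjoint B * mat_adjoint A)"
  then have i: "i < k" and j: "j < n"
    using mat_adjoint_carrier[OF A] mat_adjoint_carrier[OF B] by auto
  have AB: "A * B \<in> carrier_mat n k" using A B by simp
  show "mat_adjoint (A * B) $$ (i, j) = (mat_adjoint B * mat_adjoint A) $$ (i, j)"
    unfolding index_mat_adjoint[OF AB i j]
      index_mult_mat_sum[OF A B j i]
      index_mult_mat_sum[OF mat_adjoint_carrier[OF B] mat_adjoint_carrier[OF A] i j]
    using i j A B
    by (auto simp: index_mat_adjoint[OF A] index_mat_adjoint[OF B] mult.commute intro!: sum.cong)
qed (use assms in \<open>auto simp: mat_adjoint_eq_mat\<close>)

lemma mat_adjoint_adjoint [simp]: "mat_adjoint (mat_adjoint A) = (A :: complex mat)"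
  by (rule eq_matI) (auto simp: mat_adjoint_eq_mat)

text \<open>\<open>corthogonal\<close> asks for vanishing inner products of distinct vectors and
  nonzero ones of each vector with itself, so dividing every column by its Euclidean norm
  \<open>c j\<close> is legitimate and makes the columns orthonormal.\<close>

lemma unitary_of_corthogonal:
  fixes ws :: "complex vec list"
  assumes ws: "set ws \<subseteq> carrier_vec n" "corthogonal ws" "length ws = n"
  obtains c where "\<And>j. j < n \<Longrightarrow> c j \<noteq> 0"
    "mat_adjoint (mat n n (\<lambda>(i, j). ws ! j $ i / c j)) * mat n n (\<lambda>(i, j). ws ! j $ i / c j) = 1\<^sub>m n"
proof -
  define c where "c j = complex_of_real (sqrt (\<Sum>a<n. (cmod (ws ! j $ a))\<^sup>2))" for j
  have wsc: "ws ! j \<in> carrier_vec n" if "j < n" for j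
    using ws that by (metis nth_mem subsetD)
  have sq: "c j * c j = (\<Sum>a<n. ws ! j $ a * cnj (ws ! j $ a))" for j
  proof -
    have "c j * c j = complex_of_real (\<Sum>a<n. (cmod (ws ! j $ a))\<^sup>2)"
      unfolding c_def of_real_mult[symmetric] by (simp add: sum_nonneg)
    then show ?thesis by (simp only: complex_norm_square of_real_sum)
  qed
  have ip: "(\<Sum>a<n. ws ! i $ a * cnj (ws ! j $ a)) = 0 \<longleftrightarrow> i \<noteq> j" if "i < n" "j < n" for i j
    using corthogonalD[OF ws(2), of i j] that ws(3) wsc[OF that(1)] wsc[OF that(2)]
    by (auto simp: scalar_prod_def lessThan_atLeast0)
  have c0: "c j \<noteq> 0" if "j < n" for j using sq[of j] ip[OF that that] by auto
  have cc: "cnj (c j) = c j" for j by (simp add: c_def)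
  let ?W = "mat n n (\<lambda>(i, j). ws ! j $ i / c j)"
  have W: "?W \<in> carrier_mat n n" by simp
  have "mat_adjoint ?W * ?W = 1\<^sub>m n"
  proof (rule eq_matI)
    fix i j assume "i < dim_row (1\<^sub>m n)" "j < dim_col (1\<^sub>m n)"
    then have i: "i < n" and j: "j < n" by auto
    have "(mat_adjoint ?W * ?W) $$ (i, j) = (\<Sum>a<n. ws ! j $ a * cnj (ws ! i $ a)) / (c i * c j)"
      unfolding index_mult_mat_sum[OF mat_adjoint_carrier[OF W] W i j] sum_divide_distrib
      by (rule sum.cong) (use i j in \<open>auto simp: index_mat_adjoint[OF W] cc\<close>)
    also have "\<dots> = (if i = j then 1 else 0)"
      using ip[OF j i] sq[of j] c0[OF j] by (auto simp: divide_simps)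
    finally show "(mat_adjoint ?W * ?W) $$ (i, j) = 1\<^sub>m n $$ (i, j)" using i j by simp
  qed (auto simp: mat_adjoint_eq_mat)
  with c0 show ?thesis by (rule that)
qed

lemma unitary_adjoint:
  fixes U :: "complex mat"
  assumes "U \<in> carrier_mat n n" "mat_adjoint U * U = 1\<^sub>m n"
  shows "U * mat_adjoint U = 1\<^sub>m n"
  using assms mat_mult_left_right_inverse[OF mat_adjoint_carrier[OF assms(1)] assms(1)] by simp

text \<open>Complete \<open>v\<close> to a basis and orthogonalise by Gram-Schmidt, which keeps the
  first vector; normalising then only rescales \<open>v\<close> by some \<open>c\<close>.\<close>

lemma unitary_with_first_column:
  fixes v :: "complex vec"
  assumes v: "v \<in> carrier_vec n" "v \<noteq> 0\<^sub>v n"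
  obtains U c where "U \<in> carrier_mat n n" "mat_adjoint U * U = 1\<^sub>m n" "\<And>i. i < n \<Longrightarrow> U $$ (i, 0) = v $ i / c"
proof -
  interpret cof_vec_space n "TYPE(complex)" .
  have n: "n \<noteq> 0" using v by auto
  define b where "b = basis_completion v"
  define ws where "ws = gram_schmidt n b"
  note bc = basis_completion[OF v, folded b_def]
  obtain vs where bv: "b = v # vs" using bc n by (cases b) auto
  have ws: "set ws \<subseteq> carrier_vec n" "corthogonal ws" "length ws = n"
    using gram_schmidt_result[OF bc(2) bc(4) bc(5) ws_def] bc by auto
  have hd: "ws ! 0 = v"
    using gram_schmidt_hd[OF v(1), of vs] n ws(3) unfolding ws_def bv
    by (metis hd_conv_nth list.size(3))
  obtain c where c: "\<And>j. j < n \<Longrightarrow> c j \<noteq> 0"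
    "mat_adjoint (mat n n (\<lambda>(i, j). ws ! j $ i / c j)) * mat n n (\<lambda>(i, j). ws ! j $ i / c j) = 1\<^sub>m n"
    using unitary_of_corthogonal[OF ws] by blast
  show ?thesis by (rule that[OF _ c(2), of "c 0"]) (use hd n in auto)
qed

text \<open>Deflation: conjugation by a unitary whose first column is an eigenvector for
  \<open>e\<close> clears the first column below \<open>e\<close>, and Hermiticity clears the first
  row. The remaining block is Hermitian with characteristic roots \<open>es\<close>, so induction
  applies. The diagonal keeps the order of the given list, which later allows a sorted one.\<close>

lemma hermitian_spectral:
  fixes A :: "complex mat"
  assumes "A \<in> carrier_mat n n" "mat_adjoint A = A" "char_poly A = (\<Prod>e\<leftarrow>es. [:- e, 1:])"
  shows "\<exists>U \<in> carrier_mat n n. mat_adjoint U * U = 1\<^sub>m n \<and> A = U * mat_diag n ((!) es) * mat_adjoint U"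
  using assms
proof (induction es arbitrary: n A)
  case Nil
  then have "n = 0" using degree_monic_char_poly[of A n] by auto
  with Nil show ?case by (intro bexI[of _ "1\<^sub>m n"] conjI eq_matI) (auto simp: mat_adjoint_eq_mat)
next
  case (Cons e es)
  note A = Cons.prems(1) and herm = Cons.prems(2) and cp = Cons.prems(3)
  have "degree (char_poly A) = Suc (length es)"
    using degree_linear_factors[of uminus "e # es"] cp by simp
  then obtain m where n: "n = Suc m" using degree_monic_char_poly[OF A] by simp
  have "eigenvalue A e" unfolding eigenvalue_root_char_poly[OF A] cp by simp
  then obtain v where "eigenvector A v e" unfolding eigenvalue_def ..
  then have v: "v \<in> carrier_vec n" "v \<noteq> 0\<^sub>v n" "A *\<^sub>v v = e \<cdot>\<^sub>v v"
    using A by (auto simp: eigenvector_def)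
  obtain W c where W: "W \<in> carrier_mat n n" and WW: "mat_adjoint W * W = 1\<^sub>m n"
    and W0: "\<And>i. i < n \<Longrightarrow> W $$ (i, 0) = v $ i / c"
    using unitary_with_first_column[OF v(1,2)] by metis
  note WW' = unitary_adjoint[OF W WW]
  define A' where "A' = mat_adjoint W * A * W"
  note Wa = mat_adjoint_carrier[OF W]
  have A': "A' \<in> carrier_mat n n" unfolding A'_def using W Wa A by simp
  have A'herm: "mat_adjoint A' = A'"
    unfolding A'_def using W Wa A herm
    by (simp add: mat_adjoint_mult[of _ n n _ n] assoc_mult_mat[of _ n n _ n _ n])
  have AA': "A = W * A' * mat_adjoint W"
  proof -
    have "W * A' * mat_adjoint W = (W * mat_adjoint W) * A * (W * mat_adjoint W)"
      unfolding A'_def using W Wa A by (simp add: assoc_mult_mat[of _ n n _ n _ n])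
    then show ?thesis using A WW' by simp
  qed
  have AW: "(A * W) $$ (a, 0) = e * W $$ (a, 0)" if a: "a < n" for a
  proof -
    have "(\<Sum>b<n. A $$ (a, b) * v $ b) = e * v $ a"
      using arg_cong[OF v(3), of "\<lambda>x. x $ a"] a A v(1)
      by (simp add: scalar_prod_def lessThan_atLeast0)
    then have "(\<Sum>b<n. A $$ (a, b) * (v $ b / c)) = e * (v $ a / c)"
      by (simp add: sum_divide_distrib[symmetric])
    moreover have "(A * W) $$ (a, 0) = (\<Sum>b<n. A $$ (a, b) * (v $ b / c))"
      by (subst index_mult_mat_sum[OF A W a]) (use n W0 in auto)
    ultimately show ?thesis using W0[OF a] by simp
  qed
  \<comment> \<open>By the eigenvector equation the first column of \<open>A'\<close> is
    \<open>e\<close> times the first column of \<open>mat_adjoint W * W = 1\<close>.\<close>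
  have col: "A' $$ (i, 0) = (if i = 0 then e else 0)" if i: "i < n" for i
  proof -
    have "A' $$ (i, 0) = (mat_adjoint W * (A * W)) $$ (i, 0)"
      unfolding A'_def using Wa A W by (simp add: assoc_mult_mat[of _ n n _ n _ n])
    also have "\<dots> = (\<Sum>a<n. mat_adjoint W $$ (i, a) * (A * W) $$ (a, 0))"
      by (rule index_mult_mat_sum[OF Wa _ i]) (use n W A in auto)
    also have "\<dots> = e * (\<Sum>a<n. mat_adjoint W $$ (i, a) * W $$ (a, 0))"
      unfolding sum_distrib_left by (rule sum.cong) (use AW in auto)
    also have "(\<Sum>a<n. mat_adjoint W $$ (i, a) * W $$ (a, 0)) = (1\<^sub>m n :: complex mat) $$ (i, 0)"
      unfolding WW[symmetric] by (rule index_mult_mat_sum[OF Wa W i, symmetric]) (use n in auto)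
    finally show ?thesis using i n by simp
  qed
  have row: "A' $$ (0, j) = (if j = 0 then e else 0)" if j: "j < n" for j
    using index_mat_adjoint[OF A', of 0 j] col[OF j] col[of 0] j n A'herm by (cases "j = 0") auto
  define A3 where "A3 = mat m m (\<lambda>(i, j). A' $$ (Suc i, Suc j))"
  let ?E = "mat 1 1 (\<lambda>_. e)"
  have A3: "A3 \<in> carrier_mat m m" by (simp add: A3_def)
  have E: "?E \<in> carrier_mat 1 1" by simp
  have blk: "A' = four_block_mat ?E (0\<^sub>m 1 m) (0\<^sub>m m 1) A3"
    by (rule eq_matI) (use A' n col row in \<open>auto simp: A3_def\<close>)
  have A3h: "mat_adjoint A3 = A3"
  proof (rule eq_matI)
    fix i j assume "i < dim_row A3" "j < dim_col A3"
    then have ij: "i < m" "j < m" by (auto simp: A3_def)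
    then show "mat_adjoint A3 $$ (i, j) = A3 $$ (i, j)"
      using index_mat_adjoint[OF A', of "Suc i" "Suc j"] A'herm n
      by (simp add: index_mat_adjoint[OF A3], simp add: A3_def)
  qed (auto simp: A3_def mat_adjoint_eq_mat)
  \<comment> \<open>Similarity preserves the characteristic polynomial, and the block form splits
    off the factor of the 1x1 block; cancelling it leaves the induction hypothesis for
    \<open>A3\<close>.\<close>
  have sim: "similar_mat A A'"
    by (rule similar_matI[OF _ WW' WW AA']) (use A A' W Wa in auto)
  have "char_poly ?E * char_poly A3 = [:- e, 1:] * (\<Prod>e\<leftarrow>es. [:- e, 1:])"
    using char_poly_four_block_zeros_col[OF E zero_carrier_mat A3, folded blk]
      char_poly_similar[OF sim] cp by simp
  moreover have "char_poly ?E = [:- e, 1:]"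
    by (simp add: char_poly_defs det_def sign_def)
  ultimately have "char_poly A3 = (\<Prod>e\<leftarrow>es. [:- e, 1:])"
    by (metis mult_cancel_left pCons_eq_0_iff zero_neq_one)
  from Cons.IH[OF A3 A3h this] obtain V where V: "V \<in> carrier_mat m m"
    and VV: "mat_adjoint V * V = 1\<^sub>m m" and A3V: "A3 = V * mat_diag m ((!) es) * mat_adjoint V"
    by auto
  note Va = mat_adjoint_carrier[OF V]
  \<comment> \<open>The diagonalising unitary is \<open>W\<close> times the extension of
    \<open>V\<close> that fixes the first basis vector.\<close>
  let ?F = "four_block_mat (1\<^sub>m 1) (0\<^sub>m 1 m) (0\<^sub>m m 1) V"
  let ?G = "four_block_mat (1\<^sub>m 1) (0\<^sub>m 1 m) (0\<^sub>m m 1) (mat_adjoint V)"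
  let ?D = "mat_diag n ((!) (e # es))"
  have F: "?F \<in> carrier_mat n n" and G: "?G \<in> carrier_mat n n" using V Va n by auto
  have D: "?D \<in> carrier_mat n n" by simp
  have FG: "mat_adjoint ?F = ?G"
    by (rule eq_matI) (use V n in \<open>auto simp: mat_adjoint_eq_mat\<close>)
  have GF: "?G * ?F = 1\<^sub>m n"
    by (subst mult_four_block_mat[of _ 1 1 _ m _ m _ _ 1 _ m])
      (use V Va VV n in \<open>auto intro!: eq_matI\<close>)
  have Dblk: "?D = four_block_mat ?E (0\<^sub>m 1 m) (0\<^sub>m m 1) (mat_diag m ((!) es))"
    by (rule eq_matI) (use n in \<open>auto simp: mat_diag_def nth_Cons split: nat.splits\<close>)
  have Dm: "mat_diag m ((!) es) \<in> carrier_mat m m" by simp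
  have VD: "V * mat_diag m ((!) es) \<in> carrier_mat m m" using V Dm by simp
  have FD: "?F * ?D = four_block_mat ?E (0\<^sub>m 1 m) (0\<^sub>m m 1) (V * mat_diag m ((!) es))"
    unfolding Dblk
    by (subst mult_four_block_mat[of _ 1 1 _ m _ m _ _ 1 _ m]) (use V E in \<open>auto simp: left_mult_zero_mat[OF Dm]\<close>)
  have FDG: "?F * ?D * ?G = A'"
    unfolding FD blk A3V
    by (subst mult_four_block_mat[of _ 1 1 _ m _ m _ _ 1 _ m]) (use V Va VD E in \<open>auto simp: left_mult_zero_mat[OF Va] right_mult_zero_mat[OF VD]\<close>)
  let ?U = "W * ?F"
  have U: "?U \<in> carrier_mat n n" using W F by simp
  have Ua: "mat_adjoint ?U = ?G * mat_adjoint W" using mat_adjoint_mult[OF W F] FG by simp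
  have "mat_adjoint ?U * ?U = ?G * ((mat_adjoint W * W) * ?F)"
    unfolding Ua using W Wa F G by (simp add: assoc_mult_mat[of _ n n _ n _ n])
  then have UU: "mat_adjoint ?U * ?U = 1\<^sub>m n" unfolding WW left_mult_one_mat[OF F] GF .
  have "?U * X * mat_adjoint ?U = W * (?F * X * ?G) * mat_adjoint W" if "X \<in> carrier_mat n n" for X
    unfolding Ua using W Wa F G that by (simp add: assoc_mult_mat[of _ n n _ n _ n])
  from this[OF D] have "?U * ?D * mat_adjoint ?U = W * (?F * ?D * ?G) * mat_adjoint W" .
  then have "A = ?U * ?D * mat_adjoint ?U" using FDG AA' by simp
  with U UU show ?case by blast
qed

section \<open>Orthonormal bases, eigenvector expansions and quadratic forms\<close>

definition ip :: "nat \<Rightarrow> (nat \<Rightarrow> complex) \<Rightarrow> (nat \<Rightarrow> complex) \<Rightarrow> complex" where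
  "ip n f g = (\<Sum>a<n. cnj (f a) * g a)"

definition quad :: "nat \<Rightarrow> complex mat \<Rightarrow> (nat \<Rightarrow> complex) \<Rightarrow> complex" where
  "quad n A f = (\<Sum>a<n. \<Sum>b<n. cnj (f a) * A $$ (a, b) * f b)"

text \<open>For the matrix \<open>U\<close> with columns \<open>u i\<close> the two clauses are
  \<open>U* U = 1\<close> and \<open>U U* = 1\<close>: orthonormality and the resolution of the
  identity.\<close>

definition onb :: "nat \<Rightarrow> (nat \<Rightarrow> nat \<Rightarrow> complex) \<Rightarrow> bool" where
  "onb n u \<longleftrightarrow> (\<forall>i<n. \<forall>j<n. ip n (u i) (u j) = of_bool (i = j)) \<and>
     (\<forall>a<n. \<forall>b<n. (\<Sum>i<n. u i a * cnj (u i b)) = of_bool (a = b))"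

definition eigen_expansion :: "nat \<Rightarrow> complex mat \<Rightarrow> (nat \<Rightarrow> complex) \<Rightarrow> (nat \<Rightarrow> nat \<Rightarrow> complex) \<Rightarrow> bool" where
  "eigen_expansion n A e u \<longleftrightarrow> (\<forall>a<n. \<forall>b<n. A $$ (a, b) = (\<Sum>i<n. e i * u i a * cnj (u i b)))"

lemma ip_commute: "ip n g f = cnj (ip n f g)"
  by (simp add: ip_def mult.commute)

lemma cmod_ip_commute: "cmod (ip n f g) = cmod (ip n g f)"
  by (metis complex_mod_cnj ip_commute)

lemma ip_self: "ip n f f = complex_of_real (\<Sum>a<n. (cmod (f a))\<^sup>2)"
  by (simp only: ip_def complex_norm_square of_real_sum mult.commute)

lemma onb_norm:
  assumes "onb n u" "i < n"
  shows "(\<Sum>a<n. (cmod (u i a))\<^sup>2) = 1"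
proof -
  have "complex_of_real (\<Sum>a<n. (cmod (u i a))\<^sup>2) = 1"
    unfolding ip_self[symmetric] using assms by (simp add: onb_def)
  then show ?thesis by (simp only: of_real_eq_1_iff)
qed

lemma hermitian_onb:
  assumes A: "A \<in> carrier_mat n n" "mat_adjoint A = A" "char_poly A = (\<Prod>e\<leftarrow>es. [:- e, 1:])"
  obtains u where "onb n u" "eigen_expansion n A ((!) es) u"
proof -
  obtain U where U: "U \<in> carrier_mat n n" and UU: "mat_adjoint U * U = 1\<^sub>m n"
    and AU: "A = U * mat_diag n ((!) es) * mat_adjoint U"
    using hermitian_spectral[OF A] by blast
  note UU' = unitary_adjoint[OF U UU] and Ua = mat_adjoint_carrier[OF U]
  let ?u = "\<lambda>i a. U $$ (a, i)"
  have "ip n (?u i) (?u j) = of_bool (i = j)" if "i < n" "j < n" for i j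
    using index_mult_mat_sum[OF Ua U that] that unfolding UU ip_def
    by (auto simp: index_mat_adjoint[OF U] split: if_splits)
  moreover have "(\<Sum>i<n. ?u i a * cnj (?u i b)) = of_bool (a = b)" if "a < n" "b < n" for a b
    using index_mult_mat_sum[OF U Ua that] that unfolding UU'
    by (auto simp: index_mat_adjoint[OF U] split: if_splits)
  ultimately have "onb n ?u" by (auto simp: onb_def)
  moreover have "A $$ (a, b) = (\<Sum>i<n. es ! i * ?u i a * cnj (?u i b))" if "a < n" "b < n" for a b
  proof -
    have UD: "U * mat_diag n ((!) es) \<in> carrier_mat n n" using U by simp
    have "A $$ (a, b) = (\<Sum>i<n. (U * mat_diag n ((!) es)) $$ (a, i) * mat_adjoint U $$ (i, b))"
      unfolding index_mult_mat_sum[OF UD Ua that, symmetric] using AU by simp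
    also have "\<dots> = (\<Sum>i<n. es ! i * ?u i a * cnj (?u i b))"
      by (rule sum.cong) (use that in \<open>simp_all add: mat_diag_mult_right[OF U] index_mat_adjoint[OF U]\<close>)
    finally show ?thesis .
  qed
  then have "eigen_expansion n A ((!) es) ?u" by (auto simp: eigen_expansion_def)
  ultimately show ?thesis by (rule that)
qed

lemma quad_expansion:
  assumes "eigen_expansion n A e u"
  shows "quad n A f = (\<Sum>i<n. e i * (cmod (ip n (u i) f))\<^sup>2)"
proof -
  have "cnj (f a) * A $$ (a, b) * f b = (\<Sum>i<n. e i * (cnj (u i b) * f b) * (u i a * cnj (f a)))"
    if "a < n" "b < n" for a b
  proof -
    have "cnj (f a) * A $$ (a, b) * f b = (cnj (f a) * f b) * (\<Sum>i<n. e i * u i a * cnj (u i b))"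
      using assms that by (simp add: eigen_expansion_def)
    also have "\<dots> = (\<Sum>i<n. e i * (cnj (u i b) * f b) * (u i a * cnj (f a)))"
      unfolding sum_distrib_left by (rule sum.cong) (simp_all add: ac_simps)
    finally show ?thesis .
  qed
  then have "quad n A f = (\<Sum>a<n. \<Sum>b<n. \<Sum>i<n. e i * (cnj (u i b) * f b) * (u i a * cnj (f a)))"
    unfolding quad_def by (intro sum.cong refl) simp_all
  also have "\<dots> = (\<Sum>a<n. \<Sum>i<n. \<Sum>b<n. e i * (cnj (u i b) * f b) * (u i a * cnj (f a)))"
    by (intro sum.cong refl sum.swap)
  also have "\<dots> = (\<Sum>i<n. \<Sum>a<n. \<Sum>b<n. e i * (cnj (u i b) * f b) * (u i a * cnj (f a)))"
    by (rule sum.swap)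
  also have "\<dots> = (\<Sum>i<n. e i * (ip n (u i) f * cnj (ip n (u i) f)))"
  proof (rule sum.cong[OF refl])
    fix i
    have "ip n (u i) f * cnj (ip n (u i) f) = (\<Sum>a<n. u i a * cnj (f a)) * (\<Sum>b<n. cnj (u i b) * f b)"
      by (simp add: ip_def mult.commute)
    also have "\<dots> = (\<Sum>a<n. \<Sum>b<n. (u i a * cnj (f a)) * (cnj (u i b) * f b))"
      by (rule sum_product)
    finally show "(\<Sum>a<n. \<Sum>b<n. e i * (cnj (u i b) * f b) * (u i a * cnj (f a))) =
        e i * (ip n (u i) f * cnj (ip n (u i) f))"
      by (simp add: sum_distrib_left ac_simps)
  qed
  finally show ?thesis by (simp only: complex_norm_square)
qed

lemma quad_eigenvector:
  assumes "onb n u" "eigen_expansion n A e u" "j < n"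
  shows "quad n A (u j) = e j"
proof -
  have "quad n A (u j) = (\<Sum>i<n. if i = j then e i else 0)"
    unfolding quad_expansion[OF assms(2)]
    by (rule sum.cong) (use assms in \<open>auto simp: onb_def\<close>)
  then show ?thesis using assms(3) by simp
qed

text \<open>The resolution of the identity in \<open>onb\<close> is an eigenvector expansion of the
  identity matrix with all eigenvalues 1, so this is \<open>quad_expansion\<close> for that
  matrix.\<close>

lemma parseval:
  assumes "onb n u"
  shows "(\<Sum>i<n. (cmod (ip n (u i) f))\<^sup>2) = (\<Sum>a<n. (cmod (f a))\<^sup>2)"
proof -
  have "eigen_expansion n (1\<^sub>m n) (\<lambda>_. 1) u"
    using assms by (auto simp: eigen_expansion_def onb_def)
  from quad_expansion[OF this, of f]
  have "complex_of_real (\<Sum>i<n. (cmod (ip n (u i) f))\<^sup>2) = quad n (1\<^sub>m n) f"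
    by simp
  also have "\<dots> = (\<Sum>a<n. \<Sum>b<n. if a = b then cnj (f a) * f b else 0)"
    unfolding quad_def by (intro sum.cong refl) auto
  also have "\<dots> = ip n f f"
    by (simp add: ip_def)
  finally show ?thesis unfolding ip_self by (simp only: of_real_eq_iff)
qed

lemma trace_expansion:
  assumes "onb n u" "eigen_expansion n A e u"
  shows "(\<Sum>a<n. A $$ (a, a)) = (\<Sum>i<n. e i)"
proof -
  have "(\<Sum>a<n. A $$ (a, a)) = (\<Sum>a<n. \<Sum>i<n. e i * (cnj (u i a) * u i a))"
    by (intro sum.cong refl) (use assms in \<open>auto simp: eigen_expansion_def ac_simps\<close>)
  also have "\<dots> = (\<Sum>i<n. \<Sum>a<n. e i * (cnj (u i a) * u i a))" by (rule sum.swap)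
  also have "\<dots> = (\<Sum>i<n. e i * ip n (u i) (u i))" by (simp add: ip_def sum_distrib_left)
  also have "\<dots> = (\<Sum>i<n. e i)" using assms(1) by (simp add: onb_def)
  finally show ?thesis .
qed

lemma hermitian_quad_real:
  assumes A: "A \<in> carrier_mat n n" "mat_adjoint A = A"
  shows "cnj (quad n A f) = quad n A f"
proof -
  have "cnj (quad n A f) = (\<Sum>a<n. \<Sum>b<n. cnj (f b) * A $$ (b, a) * f a)"
    unfolding quad_def cnj_sum
  proof (intro sum.cong refl)
    fix a b assume "a \<in> {..<n}" "b \<in> {..<n}"
    then show "cnj (cnj (f a) * A $$ (a, b) * f b) = cnj (f b) * A $$ (b, a) * f a"
      using index_mat_adjoint[OF A(1), of b a] A(2) by simp
  qed
  also have "\<dots> = quad n A f" unfolding quad_def by (rule sum.swap)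
  finally show ?thesis .
qed

section \<open>Sorted spectra and the trace norm\<close>

text \<open>Turns equations between characteristic polynomials into equations between multisets of
  eigenvalues.\<close>

lemma proots_linear_factors: "proots (\<Prod>x\<leftarrow>l. [:- x, 1:]) = mset (l :: 'a :: idom list)"
proof (induction l)
  case (Cons x l)
  have "(\<Prod>x\<leftarrow>l. [:- x, 1:]) \<noteq> 0" by (auto simp: prod_list_zero_iff)
  then have "proots ([:- x, 1:] * (\<Prod>x\<leftarrow>l. [:- x, 1:])) = {#x#} + mset l"
    using Cons.IH by (subst proots_mult) auto
  then show ?case by simp
qed simp

lemma sorted_desc_unique:
  fixes l :: "real list"
  assumes "sorted_wrt (\<ge>) l" "sorted_wrt (\<ge>) l'" "mset l = mset l'"
  shows "l = l'"
proof -
  have s: "sorted (rev l)" "sorted (rev l')" using assms(1,2) by (auto simp: sorted_wrt_rev)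
  have "mset (rev l) = mset (rev l')" using assms(3) by simp
  from properties_for_sort[OF this s(1)] properties_for_sort[OF refl s(2)]
  have "rev l = rev l'" by metis
  then show ?thesis by simp
qed

text \<open>\<open>spec_desc\<close> is defined by choice, so a witness is required: the real parts
  of the complex eigenvalues in decreasing order. They have the right characteristic polynomial
  because the eigenvalues are real.\<close>

lemma spec_desc_char_poly:
  assumes A: "A \<in> carrier_mat n n" "mat_adjoint A = A"
  shows "length (spec_desc A) = n" and "sorted_wrt (\<ge>) (spec_desc A)"
    and "char_poly A = (\<Prod>x\<leftarrow>spec_desc A. [:- complex_of_real x, 1:])"
proof -
  obtain es where es: "char_poly A = (\<Prod>e\<leftarrow>es. [:- e, 1:])" "length es = n"
    using char_poly_factorized[OF A(1)] by auto
  obtain u where u: "onb n u" "eigen_expansion n A ((!) es) u"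
    using hermitian_onb[OF A es(1)] .
  have real: "complex_of_real (Re e) = e" if e: "e \<in> set es" for e
  proof -
    obtain i where i: "i < n" "e = es ! i" using e es(2) by (auto simp: in_set_conv_nth)
    \<comment> \<open>An eigenvalue is the value of the quadratic form at its unit eigenvector, and
      that form is real.\<close>
    then have "cnj e = e" using quad_eigenvector[OF u i(1)] hermitian_quad_real[OF A, of "u i"] by simp
    then show ?thesis by (simp add: complex_eq_iff)
  qed
  define l where "l = rev (sort (map Re es))"
  have "map complex_of_real (map Re es) = es" using real by (simp add: map_idI)
  moreover have "mset l = mset (map Re es)" by (simp add: l_def)
  ultimately have ms: "mset (map complex_of_real l) = mset es" by (metis mset_map)
  have "(\<Prod>x\<leftarrow>l. [:- complex_of_real x, 1:]) = prod_mset (image_mset (\<lambda>e. [:- e, 1:]) (mset (map complex_of_real l)))"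
    by (simp add: prod_mset_prod_list[symmetric] multiset.map_comp o_def)
  also have "\<dots> = (\<Prod>e\<leftarrow>es. [:- e, 1:])" unfolding ms
    by (simp add: prod_mset_prod_list[symmetric])
  finally have "length l = dim_row A \<and> sorted_wrt (\<ge>) l \<and> char_poly A = (\<Prod>x\<leftarrow>l. [:- complex_of_real x, 1:])"
    using es A by (simp add: l_def sorted_wrt_rev)
  then have "length (spec_desc A) = dim_row A \<and> sorted_wrt (\<ge>) (spec_desc A) \<and>
      char_poly A = (\<Prod>x\<leftarrow>spec_desc A. [:- complex_of_real x, 1:])"
    unfolding spec_desc_def by (rule someI)
  then show "length (spec_desc A) = n" and "sorted_wrt (\<ge>) (spec_desc A)"
    and "char_poly A = (\<Prod>x\<leftarrow>spec_desc A. [:- complex_of_real x, 1:])"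
    using A(1) by auto
qed

lemma proots_of_real_factors:
  "proots (\<Prod>x\<leftarrow>l. [:- complex_of_real x, 1:]) = image_mset complex_of_real (mset l)"
  using proots_linear_factors[of "map complex_of_real l"] by (simp add: o_def)

lemma image_mset_of_real_cancel:
  assumes "image_mset complex_of_real M = image_mset complex_of_real N"
  shows "M = N"
  using arg_cong[OF assms, of "image_mset Re"] by (simp add: multiset.map_comp o_def)

lemma spec_desc_expansion:
  assumes A: "A \<in> carrier_mat n n" "mat_adjoint A = A"
  obtains u where "onb n u" "eigen_expansion n A (\<lambda>i. complex_of_real (spec_desc A ! i)) u"
proof -
  have "char_poly A = (\<Prod>e\<leftarrow>map complex_of_real (spec_desc A). [:- e, 1:])"
    using spec_desc_char_poly(3)[OF A] by (simp add: o_def)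
  then obtain u where u: "onb n u" "eigen_expansion n A ((!) (map complex_of_real (spec_desc A))) u"
    using hermitian_onb[OF A] by blast
  moreover have "eigen_expansion n A (\<lambda>i. complex_of_real (spec_desc A ! i)) u"
    using u(2) spec_desc_char_poly(1)[OF A] by (simp add: eigen_expansion_def)
  ultimately show ?thesis using that by blast
qed

text \<open>For Hermitian \<open>A\<close> the matrix under the root is \<open>A * A\<close>, with
  the squared eigenvalues of \<open>A\<close> as spectrum; their square roots are the absolute
  values.\<close>

lemma trace_norm_hermitian:
  assumes A: "A \<in> carrier_mat n n" "mat_adjoint A = A"
  shows "trace_norm A = (\<Sum>i<n. \<bar>spec_desc A ! i\<bar>)"
proof -
  let ?l = "spec_desc A"
  define D where "D = mat_diag n (\<lambda>i. map complex_of_real ?l ! i)"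
  note len = spec_desc_char_poly(1)[OF A]
  have cp: "char_poly A = (\<Prod>e\<leftarrow>map complex_of_real ?l. [:- e, 1:])"
    using spec_desc_char_poly(3)[OF A] by (simp add: o_def)
  obtain U where U: "U \<in> carrier_mat n n" and UU: "mat_adjoint U * U = 1\<^sub>m n"
    and AU: "A = U * D * mat_adjoint U"
    using hermitian_spectral[OF A cp] unfolding D_def by blast
  note UU' = unitary_adjoint[OF U UU] and Ua = mat_adjoint_carrier[OF U]
  have D: "D \<in> carrier_mat n n" by (simp add: D_def)
  have "A * A = U * D * (mat_adjoint U * U) * D * mat_adjoint U"
    by (subst (1 2) AU) (use U Ua D in \<open>simp add: assoc_mult_mat[of _ n n _ n _ n]\<close>)
  also have "\<dots> = U * (D * D) * mat_adjoint U"
    unfolding UU using U Ua D by (simp add: assoc_mult_mat[of _ n n _ n _ n])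
  finally have AA: "A * A = U * (D * D) * mat_adjoint U" .
  have sim: "similar_mat (A * A) (D * D)"
    by (rule similar_matI[OF _ UU' UU AA]) (use A U Ua D in auto)
  have DD: "D * D = mat_diag n (\<lambda>i. map complex_of_real ?l ! i * map complex_of_real ?l ! i)"
    by (simp add: D_def)
  have "upper_triangular (D * D)" "D * D \<in> carrier_mat n n"
    unfolding DD by (auto simp: mat_diag_def upper_triangular_def)
  then have "char_poly (A * A) = (\<Prod>a\<leftarrow>diag_mat (D * D). [:- a, 1:])"
    using char_poly_similar[OF sim] char_poly_upper_triangular by metis
  also have "diag_mat (D * D) = map (\<lambda>x. complex_of_real (x\<^sup>2)) ?l"
    unfolding DD by (rule nth_equalityI) (use len in \<open>auto simp: diag_mat_def mat_diag_def power2_eq_square\<close>)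
  finally have cpAA: "char_poly (A * A) = (\<Prod>x\<leftarrow>map (\<lambda>x. x\<^sup>2) ?l. [:- complex_of_real x, 1:])"
    by (simp add: o_def)
  have AAc: "A * A \<in> carrier_mat n n" "mat_adjoint (A * A) = A * A"
    using A mat_adjoint_mult[OF A(1) A(1)] by auto
  \<comment> \<open>Squaring may destroy the decreasing order when eigenvalues are negative, so only
    multisets are compared; the sum does not depend on the order.\<close>
  have "image_mset complex_of_real (mset (spec_desc (A * A))) =
      image_mset complex_of_real (mset (map (\<lambda>x. x\<^sup>2) ?l))"
    using arg_cong[OF spec_desc_char_poly(3)[OF AAc], of proots]
    unfolding cpAA proots_of_real_factors by simp
  then have ms: "mset (spec_desc (A * A)) = mset (map (\<lambda>x. x\<^sup>2) ?l)"
    by (rule image_mset_of_real_cancel)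
  have "trace_norm A = sum_mset (image_mset sqrt (mset (spec_desc (A * A))))"
    unfolding trace_norm_def A(2) by (metis mset_map sum_mset_sum_list)
  also have "\<dots> = (\<Sum>x\<leftarrow>?l. \<bar>x\<bar>)"
    unfolding ms by (simp add: sum_mset_sum_list[symmetric] multiset.map_comp o_def)
  also have "\<dots> = (\<Sum>i<n. \<bar>?l ! i\<bar>)"
    using len by (simp add: sum_list_sum_nth lessThan_atLeast0)
  finally show ?thesis .
qed

section \<open>Ky Fan's maximum principle\<close>

text \<open>The weight missing below \<open>k\<close> equals the weight placed from \<open>k\<close>
  on. With \<open>m = k - 1\<close>, the value \<open>l m\<close> bounds the first group of values
  from below and the second from above, so moving the weight to the first \<open>k\<close> places
  cannot decrease the sum.\<close>

lemma sorted_weighted_sum_le: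
  fixes l w :: "nat \<Rightarrow> real"
  assumes dec: "\<And>i j. i \<le> j \<Longrightarrow> j < n \<Longrightarrow> l j \<le> l i"
    and w: "\<And>i. i < n \<Longrightarrow> 0 \<le> w i" "\<And>i. i < n \<Longrightarrow> w i \<le> 1"
    and sum: "(\<Sum>i<n. w i) = real k" and k: "k \<le> n"
  shows "(\<Sum>i<n. l i * w i) \<le> (\<Sum>i<k. l i)"
proof (cases k)
  case 0
  then have "\<forall>i\<in>{..<n}. w i = 0" using sum w(1) by (subst sum_nonneg_eq_0_iff[symmetric]) auto
  with 0 show ?thesis by simp
next
  case (Suc m)
  have split: "(\<Sum>i<n. f i) = (\<Sum>i<k. f i) + (\<Sum>i=k..<n. f i)" for f :: "nat \<Rightarrow> real"
    using k by (simp add: lessThan_atLeast0 sum.atLeastLessThan_concat)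
  have "l m * (1 - w i) \<le> l i * (1 - w i)" if "i < k" for i
    using that Suc k w(2)[of i] dec[of i m] by (intro mult_right_mono) auto
  then have 1: "(\<Sum>i<k. l m * (1 - w i)) \<le> (\<Sum>i<k. l i * (1 - w i))" by (intro sum_mono) auto
  have "l i * w i \<le> l m * w i" if "k \<le> i" "i < n" for i
    using that Suc w(1)[of i] dec[of m i] by (intro mult_right_mono) auto
  then have 2: "(\<Sum>i=k..<n. l i * w i) \<le> (\<Sum>i=k..<n. l m * w i)" by (intro sum_mono) auto
  have "(\<Sum>i<k. l m * (1 - w i)) = (\<Sum>i=k..<n. l m * w i)"
    using split[of w] sum by (simp add: sum_distrib_left[symmetric] sum_subtractf)
  then show ?thesis using 1 2 split[of "\<lambda>i. l i * w i"]
    by (simp add: right_diff_distrib sum_subtractf)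
qed

text \<open>In an eigenbasis \<open>u\<close> of \<open>A\<close> the left side is a sum of
  eigenvalues weighted by \<open>w i\<close>, the squared length of the projection of
  \<open>u i\<close> onto the span of \<open>v 0, ..., v (k - 1)\<close>. This is the upper bound
  only; that eigenvectors attain it is shown where it is used.\<close>

lemma ky_fan:
  assumes A: "A \<in> carrier_mat n n" "mat_adjoint A = A" and v: "onb n v" and k: "k \<le> n"
  shows "Re (\<Sum>j<k. quad n A (v j)) \<le> (\<Sum>i<k. spec_desc A ! i)"
proof -
  let ?l = "spec_desc A"
  obtain u where u: "onb n u" "eigen_expansion n A (\<lambda>i. complex_of_real (?l ! i)) u"
    using spec_desc_expansion[OF A] .
  define w where "w i = (\<Sum>j<k. (cmod (ip n (u i) (v j)))\<^sup>2)" for i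
  have "Re (\<Sum>j<k. quad n A (v j)) = (\<Sum>j<k. \<Sum>i<n. ?l ! i * (cmod (ip n (u i) (v j)))\<^sup>2)"
    unfolding quad_expansion[OF u(2)] by (simp only: of_real_mult[symmetric] of_real_sum[symmetric] Re_complex_of_real)
  also have "\<dots> = (\<Sum>i<n. ?l ! i * w i)"
    unfolding w_def sum_distrib_left by (rule sum.swap)
  also have "\<dots> \<le> (\<Sum>i<k. ?l ! i)"
  proof (rule sorted_weighted_sum_le[OF _ _ _ _ k])
    fix i j assume "i \<le> j" "j < n"
    then show "?l ! j \<le> ?l ! i"
      using spec_desc_char_poly(1,2)[OF A] by (cases "i = j") (auto simp: sorted_wrt_iff_nth_less)
  next
    fix i assume i: "i < n"
    show "0 \<le> w i" by (simp add: w_def sum_nonneg)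
    \<comment> \<open>Bessel's inequality: enlarge to the full basis \<open>v\<close> and apply
      Parseval to the unit vector \<open>u i\<close>.\<close>
    have "w i \<le> (\<Sum>j<n. (cmod (ip n (u i) (v j)))\<^sup>2)"
      unfolding w_def using k by (intro sum_mono2) auto
    also have "\<dots> = (\<Sum>j<n. (cmod (ip n (v j) (u i)))\<^sup>2)"
      by (simp only: cmod_ip_commute[of n "u i"])
    also have "\<dots> = 1" using parseval[OF v] onb_norm[OF u(1) i] by simp
    finally show "w i \<le> 1" .
  next
    have "(\<Sum>i<n. w i) = (\<Sum>j<k. \<Sum>i<n. (cmod (ip n (u i) (v j)))\<^sup>2)"
      unfolding w_def by (rule sum.swap)
    also have "\<dots> = (\<Sum>j<k. 1)"
      by (rule sum.cong) (use k parseval[OF u(1)] onb_norm[OF v] in auto)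
    finally show "(\<Sum>i<n. w i) = real k" by simp
  qed
  finally show ?thesis .
qed

section \<open>Reduced density matrices\<close>

definition embed_set :: "nat set \<Rightarrow> nat \<Rightarrow> nat set" where
  "embed_set X a = (!) (sorted_list_of_set X) ` {k. k < card X \<and> bit a k}"

lemma nth_sorted_list_of_set:
  assumes "finite X"
  shows "inj_on ((!) (sorted_list_of_set X)) {..<card X}"
    and "(!) (sorted_list_of_set X) ` {..<card X} = X"
  using assms inj_on_nth[of "sorted_list_of_set X" "{..<card X}"]
    nth_image[of "card X" "sorted_list_of_set X"] by (auto simp: lessThan_atLeast0)

lemma embed_set_subset: "finite X \<Longrightarrow> embed_set X a \<subseteq> X"
  using nth_sorted_list_of_set(2)[of X] by (auto simp: embed_set_def)

text \<open>Viewing an index as the set of qubits in state 1 turns adding the indices of disjoint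
  subsystems into a union of sets, and injectivity of binary notation into that of
  \<open>set_encode\<close>.\<close>

lemma embed_idx_eq_set_encode:
  assumes "finite X"
  shows "embed_idx X a = set_encode (embed_set X a)"
proof -
  have "embed_idx X a = (\<Sum>k | k < card X \<and> bit a k. 2 ^ (sorted_list_of_set X ! k))"
    unfolding embed_idx_def by (rule sum.mono_neutral_cong_right) auto
  also have "\<dots> = (\<Sum>q\<in>embed_set X a. 2 ^ q)"
    unfolding embed_set_def
    by (subst sum.reindex) (auto intro: inj_on_subset[OF nth_sorted_list_of_set(1)[OF assms]])
  finally show ?thesis by (simp add: set_encode_def)
qed

lemma bit_imp_less:
  fixes a :: nat
  assumes "a < 2 ^ m" "bit a k"
  shows "k < m"
proof (rule ccontr)
  assume "\<not> k < m"
  then have "(2 :: nat) ^ m \<le> 2 ^ k" by (intro power_increasing) auto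
  with assms show False by (simp add: bit_iff_odd)
qed

lemma embed_set_inj:
  assumes X: "finite X" and eq: "embed_set X a = embed_set X b"
    and a: "a < 2 ^ card X" and b: "b < 2 ^ card X"
  shows "a = b"
proof -
  have "{k. k < card X \<and> bit a k} = {k. k < card X \<and> bit b k}"
    by (rule inj_on_image_eq_iff[THEN iffD1, OF nth_sorted_list_of_set(1)[OF X]])
      (use eq in \<open>auto simp: embed_set_def\<close>)
  then show ?thesis using bit_imp_less[OF a] bit_imp_less[OF b]
    by (auto simp: bit_eq_iff set_eq_iff)
qed

text \<open>The tensor factorisation on the level of indices. A union of a subset of
  \<open>X\<close> and a subset of \<open>Y\<close> determines both parts, which gives injectivity;
  surjectivity follows by counting, since the domain has
  \<open>2 ^ card X * 2 ^ card Y = 2 ^ n\<close> elements.\<close>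

lemma embed_pair_bij:
  fixes n :: nat
  assumes X: "X \<subseteq> {0..<n}"
  defines "Y \<equiv> {0..<n} - X"
  shows "bij_betw (\<lambda>(a, c). embed_idx X a + embed_idx Y c)
    ({..<2 ^ card X} \<times> {..<2 ^ card Y}) {..<2 ^ n}"
proof -
  let ?e = "\<lambda>(a, c). embed_idx X a + embed_idx Y c"
  let ?D = "{..<2 ^ card X} \<times> {..<2 ^ card Y} :: (nat \<times> nat) set"
  have fX: "finite X" and fY: "finite Y" using X by (auto simp: Y_def finite_subset)
  have sX: "embed_set X a \<subseteq> X" and sY: "embed_set Y a \<subseteq> Y" for a
    using embed_set_subset fX fY by auto
  have fin: "finite (embed_set X a \<union> embed_set Y c)" for a c
    using sX sY fX fY by (meson finite_UnI finite_subset)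
  have enc: "embed_idx X a + embed_idx Y c = set_encode (embed_set X a \<union> embed_set Y c)" for a c
    unfolding embed_idx_eq_set_encode[OF fX] embed_idx_eq_set_encode[OF fY] set_encode_def
    by (rule sum.union_disjoint[symmetric])
      (use fin[of a c] sX[of a] sY[of c] in \<open>auto simp: Y_def\<close>)
  have inj: "inj_on ?e ?D"
  proof (rule inj_onI, clarsimp)
    fix a c a' c' assume lt: "a < 2 ^ card X" "c < 2 ^ card Y" "a' < 2 ^ card X" "c' < 2 ^ card Y"
      and "embed_idx X a + embed_idx Y c = embed_idx X a' + embed_idx Y c'"
    then have "embed_set X a \<union> embed_set Y c = embed_set X a' \<union> embed_set Y c'"
      unfolding enc by (intro inj_onD[OF inj_on_set_encode]) (use fin in auto)
    then have "embed_set X a = embed_set X a'" "embed_set Y c = embed_set Y c'"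
      using sX[of a] sX[of a'] sY[of c] sY[of c'] by (auto simp: Y_def)
    then show "a = a' \<and> c = c'" using embed_set_inj fX fY lt by blast
  qed
  have sub: "?e ` ?D \<subseteq> {..<2 ^ n}"
  proof clarsimp
    fix a c
    have "embed_set X a \<union> embed_set Y c \<subseteq> {0..<n}" using sX[of a] sY[of c] X by (auto simp: Y_def)
    then have "set_encode (embed_set X a \<union> embed_set Y c) \<le> (\<Sum>q=0..<n. 2 ^ q)"
      unfolding set_encode_def by (intro sum_mono2) auto
    also have "\<dots> < 2 ^ n" by (simp add: sum_power2)
    finally show "embed_idx X a + embed_idx Y c < 2 ^ n" unfolding enc .
  qed
  have "card X + card Y = n"
    using X fX by (simp add: Y_def card_Diff_subset card_mono subset_eq_atLeast0_lessThan_card)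
  then have "card (?e ` ?D) = card {..<(2 :: nat) ^ n}"
    unfolding card_image[OF inj] by (simp add: card_cartesian_product power_add[symmetric])
  then have "?e ` ?D = {..<2 ^ n}" using sub by (intro card_subset_eq) auto
  with inj show ?thesis by (simp add: bij_betw_def)
qed

lemma sum_embed_pair:
  fixes n :: nat and f :: "nat \<Rightarrow> 'a :: comm_monoid_add"
  assumes "X \<subseteq> {0..<n}"
  shows "(\<Sum>c<2 ^ card ({0..<n} - X). \<Sum>a<2 ^ card X. f (embed_idx X a + embed_idx ({0..<n} - X) c)) = sum f {..<2 ^ n}"
proof -
  have "(\<Sum>c<2 ^ card ({0..<n} - X). \<Sum>a<2 ^ card X. f (embed_idx X a + embed_idx ({0..<n} - X) c)) =
      (\<Sum>a<2 ^ card X. \<Sum>c<2 ^ card ({0..<n} - X). f (embed_idx X a + embed_idx ({0..<n} - X) c))"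
    by (rule sum.swap)
  also have "\<dots> = (\<Sum>p\<in>{..<2 ^ card X} \<times> {..<2 ^ card ({0..<n} - X)}.
      f ((\<lambda>(a, c). embed_idx X a + embed_idx ({0..<n} - X) c) p))"
    by (simp add: sum.cartesian_product case_prod_beta)
  also have "\<dots> = sum f {..<2 ^ n}"
    by (rule sum.reindex_bij_betw[OF embed_pair_bij[OF assms]])
  finally show ?thesis .
qed

section \<open>Marginals as quadratic forms in the global state\<close>

lemma reduced_dm_carrier: "reduced_dm n X \<psi> \<in> carrier_mat (2 ^ card X) (2 ^ card X)"
  by (simp add: reduced_dm_def)

lemma reduced_dm_hermitian: "mat_adjoint (reduced_dm n X \<psi>) = reduced_dm n X \<psi>"
  by (rule eq_matI) (auto simp: mat_adjoint_eq_mat reduced_dm_def mult.commute)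

lemmas reduced_dm_herm = reduced_dm_carrier reduced_dm_hermitian

lemma proj_diff_hermitian:
  assumes "dim_vec \<psi> = N" "dim_vec \<phi> = N"
  shows "proj \<psi> - proj \<phi> \<in> carrier_mat N N" "mat_adjoint (proj \<psi> - proj \<phi>) = proj \<psi> - proj \<phi>"
  using assms by (auto intro!: eq_matI simp: mat_adjoint_eq_mat proj_def mult.commute)

lemma quad_outer_product:
  "(\<Sum>a<m. \<Sum>b<m. cnj (f a) * (g a * cnj (g b)) * f b) = complex_of_real ((cmod (ip m f g))\<^sup>2)"
proof -
  have "complex_of_real ((cmod (ip m f g))\<^sup>2) = (\<Sum>a<m. cnj (f a) * g a) * (\<Sum>b<m. cnj (g b) * f b)"
    unfolding complex_norm_square by (simp add: ip_def mult.commute)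
  also have "\<dots> = (\<Sum>a<m. \<Sum>b<m. cnj (f a) * g a * (cnj (g b) * f b))"
    by (rule sum_product)
  finally show ?thesis by (simp add: mult.assoc)
qed

text \<open>The marginal is the sum, over the basis states \<open>c\<close> of the complement, of
  the rank-one operators of the slices of \<open>\<psi>\<close> at \<open>c\<close>. Each slice
  contributes a squared overlap, which gives positivity and ties the marginal to
  \<open>\<psi>\<close>.\<close>

lemma quad_reduced_dm:
  fixes n :: nat
  defines "e X \<equiv> \<lambda>a c. embed_idx X a + embed_idx ({0..<n} - X) c"
  shows "quad (2 ^ card X) (reduced_dm n X \<psi>) f =
    complex_of_real (\<Sum>c<2 ^ card ({0..<n} - X). (cmod (ip (2 ^ card X) f (\<lambda>a. \<psi> $ e X a c)))\<^sup>2)"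
proof -
  let ?m = "2 ^ card X :: nat" and ?Y = "{..<2 ^ card ({0..<n} - X) :: nat}"
  have "quad ?m (reduced_dm n X \<psi>) f =
      (\<Sum>a<?m. \<Sum>b<?m. \<Sum>c\<in>?Y. cnj (f a) * (\<psi> $ e X a c * cnj (\<psi> $ e X b c)) * f b)"
    unfolding quad_def
    by (intro sum.cong refl) (simp add: reduced_dm_def e_def sum_distrib_left sum_distrib_right)
  also have "\<dots> = (\<Sum>a<?m. \<Sum>c\<in>?Y. \<Sum>b<?m. cnj (f a) * (\<psi> $ e X a c * cnj (\<psi> $ e X b c)) * f b)"
    by (intro sum.cong refl sum.swap)
  also have "\<dots> = (\<Sum>c\<in>?Y. \<Sum>a<?m. \<Sum>b<?m. cnj (f a) * (\<psi> $ e X a c * cnj (\<psi> $ e X b c)) * f b)"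
    by (rule sum.swap)
  finally show ?thesis unfolding quad_outer_product by simp
qed

text \<open>With \<open>P\<close> the projection onto the span of
  \<open>v 0, ..., v (k - 1)\<close>, the difference is the trace of \<open>P \<otimes> 1\<close>
  times \<open>B = proj \<psi> - proj \<phi>\<close>. In an eigenbasis \<open>w\<close> of
  \<open>B\<close> it becomes a sum of eigenvalues weighted by numbers in the unit interval, hence
  is at most the sum of their absolute values.\<close>

lemma reduced_dm_quad_diff:
  fixes n :: nat
  assumes X: "X \<subseteq> {0..<n}" and dims: "dim_vec \<psi> = 2 ^ n" "dim_vec \<phi> = 2 ^ n"
    and v: "onb (2 ^ card X) v" and k: "k \<le> 2 ^ card X"
  shows "\<bar>Re (\<Sum>j<k. quad (2 ^ card X) (reduced_dm n X \<psi>) (v j))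
      - Re (\<Sum>j<k. quad (2 ^ card X) (reduced_dm n X \<phi>) (v j))\<bar> \<le> trace_norm (proj \<psi> - proj \<phi>)"
proof -
  let ?m = "2 ^ card X :: nat" and ?N = "2 ^ n :: nat" and ?Y = "{..<2 ^ card ({0..<n} - X) :: nat}"
  define e where "e a c = embed_idx X a + embed_idx ({0..<n} - X) c" for a c
  let ?B = "proj \<psi> - proj \<phi>"
  note B = proj_diff_hermitian[OF dims]
  obtain w where w: "onb ?N w" "eigen_expansion ?N ?B (\<lambda>i. complex_of_real (spec_desc ?B ! i)) w"
    using spec_desc_expansion[OF B] .
  let ?\<alpha> = "\<lambda>i. spec_desc ?B ! i"
  have e: "e a c < ?N" if "a < ?m" "c \<in> ?Y" for a c
    using bij_betwE[OF embed_pair_bij[OF X]] that by (auto simp: e_def)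
  \<comment> \<open>\<open>z j c\<close> is the product vector of \<open>v j\<close> and the basis
    state \<open>c\<close> of the complement; writing it as a sum over \<open>a\<close> avoids
    inverting the index map \<open>e\<close>.\<close>
  define z where "z j c x = (\<Sum>a<?m. if e a c = x then v j a else 0)" for j c x
  have ipz: "ip ?N (z j c) f = ip ?m (v j) (\<lambda>a. f (e a c))" if "c \<in> ?Y" for j c f
  proof -
    have "ip ?N (z j c) f = (\<Sum>x<?N. \<Sum>a<?m. if e a c = x then cnj (v j a) * f x else 0)"
      unfolding ip_def z_def cnj_sum sum_distrib_right by (intro sum.cong refl) auto
    also have "\<dots> = (\<Sum>a<?m. \<Sum>x<?N. if e a c = x then cnj (v j a) * f x else 0)"
      by (rule sum.swap)
    also have "\<dots> = ip ?m (v j) (\<lambda>a. f (e a c))"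
      unfolding ip_def by (intro sum.cong refl) (use e[OF _ that] in simp)
    finally show ?thesis .
  qed
  have quad_proj: "quad ?N ?B f = complex_of_real ((cmod (ip ?N f (($) \<psi>)))\<^sup>2 - (cmod (ip ?N f (($) \<phi>)))\<^sup>2)" for f
  proof -
    have "quad ?N ?B f = (\<Sum>a<?N. \<Sum>b<?N. cnj (f a) * (\<psi> $ a * cnj (\<psi> $ b)) * f b - cnj (f a) * (\<phi> $ a * cnj (\<phi> $ b)) * f b)"
      unfolding quad_def by (intro sum.cong refl) (use dims in \<open>simp add: proj_def algebra_simps\<close>)
    then show ?thesis unfolding sum_subtractf quad_outer_product by simp
  qed
  \<comment> \<open>\<open>W i\<close> is the expectation of \<open>P \<otimes> 1\<close> in
    \<open>w i\<close>. Extending \<open>j\<close> to the whole basis and using Parseval on every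
    slice bounds it by the squared norm of \<open>w i\<close>, which is 1.\<close>
  define W where "W i = (\<Sum>j<k. \<Sum>c\<in>?Y. (cmod (ip ?N (w i) (z j c)))\<^sup>2)" for i
  have W: "\<bar>W i\<bar> \<le> 1" if i: "i < ?N" for i
  proof -
    have "W i = (\<Sum>j<k. \<Sum>c\<in>?Y. (cmod (ip ?m (v j) (\<lambda>a. w i (e a c))))\<^sup>2)"
      unfolding W_def by (intro sum.cong refl) (simp only: ipz cmod_ip_commute[of _ "w i"])
    also have "\<dots> \<le> (\<Sum>j<?m. \<Sum>c\<in>?Y. (cmod (ip ?m (v j) (\<lambda>a. w i (e a c))))\<^sup>2)"
      using k by (intro sum_mono2) (auto intro: sum_nonneg)
    also have "\<dots> = (\<Sum>c\<in>?Y. \<Sum>j<?m. (cmod (ip ?m (v j) (\<lambda>a. w i (e a c))))\<^sup>2)"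
      by (rule sum.swap)
    also have "\<dots> = 1"
      unfolding parseval[OF v] e_def sum_embed_pair[OF X, of "\<lambda>x. (cmod (w i x))\<^sup>2"] by (rule onb_norm[OF w(1) i])
    finally show ?thesis by (simp add: W_def sum_nonneg)
  qed
  have "Re (\<Sum>j<k. quad ?m (reduced_dm n X \<psi>) (v j)) - Re (\<Sum>j<k. quad ?m (reduced_dm n X \<phi>) (v j))
      = Re (\<Sum>j<k. \<Sum>c\<in>?Y. quad ?N ?B (z j c))"
    by (simp add: quad_reduced_dm quad_proj ipz e_def sum_subtractf)
  also have "\<dots> = (\<Sum>j<k. \<Sum>c\<in>?Y. \<Sum>i<?N. ?\<alpha> i * (cmod (ip ?N (w i) (z j c)))\<^sup>2)"
    unfolding quad_expansion[OF w(2)]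
    by (simp only: of_real_mult[symmetric] of_real_sum[symmetric] Re_complex_of_real)
  also have "\<dots> = (\<Sum>j<k. \<Sum>i<?N. \<Sum>c\<in>?Y. ?\<alpha> i * (cmod (ip ?N (w i) (z j c)))\<^sup>2)"
    by (intro sum.cong refl sum.swap)
  also have "\<dots> = (\<Sum>i<?N. \<Sum>j<k. \<Sum>c\<in>?Y. ?\<alpha> i * (cmod (ip ?N (w i) (z j c)))\<^sup>2)"
    by (rule sum.swap)
  also have "\<dots> = (\<Sum>i<?N. ?\<alpha> i * W i)"
    by (simp only: W_def sum_distrib_left)
  finally have eq: "Re (\<Sum>j<k. quad ?m (reduced_dm n X \<psi>) (v j)) - Re (\<Sum>j<k. quad ?m (reduced_dm n X \<phi>) (v j))
      = (\<Sum>i<?N. ?\<alpha> i * W i)" .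
  have "\<bar>\<Sum>i<?N. ?\<alpha> i * W i\<bar> \<le> (\<Sum>i<?N. \<bar>?\<alpha> i * W i\<bar>)" by (rule sum_abs)
  also have "\<dots> \<le> (\<Sum>i<?N. \<bar>?\<alpha> i\<bar>)"
    using W by (intro sum_mono) (auto simp: abs_mult intro!: mult_left_le)
  also have "\<dots> = trace_norm ?B" by (rule trace_norm_hermitian[OF B, symmetric])
  finally show ?thesis unfolding eq .
qed

lemma spec_desc_top_sum_le:
  fixes n :: nat
  assumes X: "X \<subseteq> {0..<n}" and dims: "dim_vec \<psi> = 2 ^ n" "dim_vec \<phi> = 2 ^ n" and k: "k \<le> 2 ^ card X"
  defines "T \<equiv> trace_norm (proj \<psi> - proj \<phi>)"
  shows "\<bar>(\<Sum>i<k. spec_desc (reduced_dm n X \<psi>) ! i) - (\<Sum>i<k. spec_desc (reduced_dm n X \<phi>) ! i)\<bar> \<le> T"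
proof -
  let ?m = "2 ^ card X :: nat"
  have "\<exists>v. onb ?m v \<and> (\<Sum>i<k. spec_desc (reduced_dm n X \<psi>) ! i) = Re (\<Sum>j<k. quad ?m (reduced_dm n X \<psi>) (v j))" for \<psi>
  proof -
    obtain v where v: "onb ?m v"
      "eigen_expansion ?m (reduced_dm n X \<psi>) (\<lambda>i. complex_of_real (spec_desc (reduced_dm n X \<psi>) ! i)) v"
      using spec_desc_expansion[OF reduced_dm_herm] .
    have "(\<Sum>i<k. spec_desc (reduced_dm n X \<psi>) ! i) = Re (\<Sum>j<k. quad ?m (reduced_dm n X \<psi>) (v j))"
      using quad_eigenvector[OF v] k by simp
    with v(1) show ?thesis by blast
  qed note ex = this
  obtain v where v: "onb ?m v" "(\<Sum>i<k. spec_desc (reduced_dm n X \<psi>) ! i) = Re (\<Sum>j<k. quad ?m (reduced_dm n X \<psi>) (v j))"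
    using ex by blast
  obtain v' where v': "onb ?m v'" "(\<Sum>i<k. spec_desc (reduced_dm n X \<phi>) ! i) = Re (\<Sum>j<k. quad ?m (reduced_dm n X \<phi>) (v' j))"
    using ex by blast
  \<comment> \<open>For each of the two signs, take the eigenvectors that attain the top sum of one
    state as trial vectors for the other: Ky Fan bounds the second sum from below, and the two
    traces on the same vectors differ by at most \<open>T\<close>.\<close>
  show ?thesis unfolding T_def
    using reduced_dm_quad_diff[OF X dims v(1) k] v(2) ky_fan[OF reduced_dm_herm v(1) k, of n \<phi>]
      reduced_dm_quad_diff[OF X dims v'(1) k] v'(2) ky_fan[OF reduced_dm_herm v'(1) k, of n \<psi>]
    by linarith
qed

lemma spec_desc_reduced_dm_nonneg:
  assumes "i < 2 ^ card X"
  shows "0 \<le> spec_desc (reduced_dm n X \<psi>) ! i"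
proof -
  obtain v where v: "onb (2 ^ card X) v"
    "eigen_expansion (2 ^ card X) (reduced_dm n X \<psi>) (\<lambda>i. complex_of_real (spec_desc (reduced_dm n X \<psi>) ! i)) v"
    using spec_desc_expansion[OF reduced_dm_herm] .
  have "spec_desc (reduced_dm n X \<psi>) ! i = Re (quad (2 ^ card X) (reduced_dm n X \<psi>) (v i))"
    using quad_eigenvector[OF v assms] by simp
  then show ?thesis unfolding quad_reduced_dm by (simp add: sum_nonneg)
qed

text \<open>The eigenvalues sum to the trace, and the diagonal of the marginal collects the squared
  modulus of every amplitude exactly once.\<close>

lemma spec_desc_reduced_dm_sum:
  assumes X: "X \<subseteq> {0..<n}" and q: "qstate n \<psi>"
  shows "(\<Sum>i<2 ^ card X. spec_desc (reduced_dm n X \<psi>) ! i) = 1"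
proof -
  obtain v where v: "onb (2 ^ card X) v"
    "eigen_expansion (2 ^ card X) (reduced_dm n X \<psi>) (\<lambda>i. complex_of_real (spec_desc (reduced_dm n X \<psi>) ! i)) v"
    using spec_desc_expansion[OF reduced_dm_herm] .
  let ?e = "\<lambda>a c. embed_idx X a + embed_idx ({0..<n} - X) c"
  have "complex_of_real (\<Sum>i<2 ^ card X. spec_desc (reduced_dm n X \<psi>) ! i) =
      (\<Sum>a<2 ^ card X. reduced_dm n X \<psi> $$ (a, a))"
    unfolding trace_expansion[OF v] by simp
  also have "\<dots> = (\<Sum>a<2 ^ card X. \<Sum>c<2 ^ card ({0..<n} - X). complex_of_real ((cmod (\<psi> $ ?e a c))\<^sup>2))"
    by (intro sum.cong refl) (simp only: complex_norm_square, simp add: reduced_dm_def)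
  also have "\<dots> = (\<Sum>c<2 ^ card ({0..<n} - X). \<Sum>a<2 ^ card X. complex_of_real ((cmod (\<psi> $ ?e a c))\<^sup>2))"
    by (rule sum.swap)
  also have "\<dots> = (\<Sum>x<2 ^ n. complex_of_real ((cmod (\<psi> $ x))\<^sup>2))"
    by (rule sum_embed_pair[OF X])
  also have "\<dots> = complex_of_real 1"
    using q by (simp only: of_real_sum[symmetric] qstate_def)
  finally show ?thesis by (simp only: of_real_eq_iff)
qed

section \<open>Equality of the two marginal spectra up to zeros\<close>

lemma char_poly_neq_0: "A \<in> carrier_mat n n \<Longrightarrow> char_poly (A :: complex mat) \<noteq> 0"
  using degree_monic_char_poly[of A n] by auto

lemma proots_char_poly_zero: "proots (char_poly (0\<^sub>m m m :: complex mat)) = replicate_mset m 0"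
proof -
  have "char_poly (0\<^sub>m m m :: complex mat) = (\<Prod>a\<leftarrow>diag_mat (0\<^sub>m m m :: complex mat). [:- a, 1:])"
    by (rule char_poly_upper_triangular[of _ m]) (auto simp: upper_triangular_def)
  then have "proots (char_poly (0\<^sub>m m m :: complex mat)) = mset (diag_mat (0\<^sub>m m m :: complex mat))"
    by (simp only: proots_linear_factors)
  also have "diag_mat (0\<^sub>m m m :: complex mat) = replicate m 0"
    by (rule nth_equalityI) (auto simp: diag_mat_def)
  finally show ?thesis by simp
qed

lemma proots_char_poly_mult_commute:
  fixes A B :: "complex mat"
  assumes A: "A \<in> carrier_mat n m" and B: "B \<in> carrier_mat m n"
  shows "proots (char_poly (A * B)) + replicate_mset m 0 = proots (char_poly (B * A)) + replicate_mset n 0"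
proof -
  \<comment> \<open>The block matrices \<open>L\<close> and \<open>R\<close> have the two spectra, padded with zeros, and are similar through \<open>P\<close>.\<close>
  let ?L = "four_block_mat (A * B) (0\<^sub>m n m) B (0\<^sub>m m m)"
  let ?R = "four_block_mat (0\<^sub>m n n) (0\<^sub>m n m) B (B * A)"
  let ?P = "four_block_mat (1\<^sub>m n) A (0\<^sub>m m n) (1\<^sub>m m)"
  let ?Q = "four_block_mat (1\<^sub>m n) (- A) (0\<^sub>m m n) (1\<^sub>m m)"
  have AB: "A * B \<in> carrier_mat n n" and BA: "B * A \<in> carrier_mat m m" and ABA: "A * (B * A) \<in> carrier_mat n m"
    using A B by auto
  have one: "four_block_mat (1\<^sub>m n) (0\<^sub>m n m) (0\<^sub>m m n) (1\<^sub>m m) = (1\<^sub>m (n + m) :: complex mat)"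
    by (rule eq_matI) auto
  have [simp]: "- 0\<^sub>m m m = (0\<^sub>m m m :: complex mat)" by (rule eq_matI) auto
  have PQ: "?P * ?Q = 1\<^sub>m (n + m)"
    by (subst mult_four_block_mat[of _ n n _ m _ m _ _ n _ m])
      (use A one in \<open>auto simp: uminus_l_inv_mat[OF A]\<close>)
  have QP: "?Q * ?P = 1\<^sub>m (n + m)"
    by (subst mult_four_block_mat[of _ n n _ m _ m _ _ n _ m])
      (use A one in \<open>auto simp: minus_r_inv_mat[OF A] minus_add_uminus_mat[OF A A, symmetric]\<close>)
  have LP: "?L * ?P = four_block_mat (A * B) (A * (B * A)) B (B * A)"
    by (subst mult_four_block_mat[of _ n n _ m _ m _ _ n _ m])
      (use A B AB in \<open>auto simp: assoc_mult_mat[OF A B A] right_mult_zero_mat[OF AB]\<close>)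
  have PR: "?P * ?R = four_block_mat (A * B) (A * (B * A)) B (B * A)"
    by (subst mult_four_block_mat[of _ n n _ m _ m _ _ n _ m])
      (use A B AB BA ABA in \<open>auto\<close>)
  have L: "?L \<in> carrier_mat (n + m) (n + m)" and R: "?R \<in> carrier_mat (n + m) (n + m)"
    and P: "?P \<in> carrier_mat (n + m) (n + m)" and Q: "?Q \<in> carrier_mat (n + m) (n + m)"
    using AB BA by auto
  have "?P * ?R * ?Q = ?L * ?P * ?Q" by (simp only: LP PR)
  also have "\<dots> = ?L * (?P * ?Q)" by (rule assoc_mult_mat[OF L P Q])
  also have "\<dots> = ?L" unfolding PQ by (rule right_mult_one_mat[OF L])
  finally have conj: "?L = ?P * ?R * ?Q" ..
  have "{?L, ?R, ?P, ?Q} \<subseteq> carrier_mat (n + m) (n + m)" using L R P Q by blast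
  from similar_matI[OF this PQ QP conj] have "similar_mat ?L ?R" .
  then have eq: "char_poly ?L = char_poly ?R" by (rule char_poly_similar)
  \<comment> \<open>The rule for block triangular matrices asks for diagonal blocks whose
    characteristic polynomials split, as they do over the complex numbers.\<close>
  have fac: "\<exists>es. char_poly C = (\<Prod>a\<leftarrow>es. [:- a, 1:])" if "C \<in> carrier_mat k k" for C :: "complex mat" and k
    using char_poly_factorized[OF that] by auto
  have zero: "0\<^sub>m k k \<in> carrier_mat k k" for k by simp
  have "char_poly (A * B) * char_poly (0\<^sub>m m m) = char_poly (0\<^sub>m n n) * char_poly (B * A)"
    using eq unfolding char_poly_0_block'[OF refl fac[OF AB] fac[OF zero] AB B zero]
      char_poly_0_block'[OF refl fac[OF zero] fac[OF BA] zero B BA] .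
  then have "proots (char_poly (A * B) * char_poly (0\<^sub>m m m)) = proots (char_poly (0\<^sub>m n n) * char_poly (B * A))"
    by simp
  then show ?thesis
    by (simp add: proots_mult char_poly_neq_0[OF AB] char_poly_neq_0[OF BA] char_poly_neq_0[OF zero]
        proots_char_poly_zero)
qed

lemma mset_spec_desc:
  assumes "A \<in> carrier_mat n n" "mat_adjoint A = A"
  shows "image_mset complex_of_real (mset (spec_desc A)) = proots (char_poly A)"
  unfolding spec_desc_char_poly(3)[OF assms] proots_of_real_factors ..

text \<open>Padding each spectrum by the dimension of the other side gives lists of equal length. As
  the spectra are nonnegative, the appended zeros keep them sorted, so equality of multisets becomes
  equality of lists, to be read entry by entry.\<close>

lemma reduced_dm_schmidt:
  assumes X: "X \<subseteq> {0..<n}"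
  defines "Y \<equiv> {0..<n} - X"
  shows "spec_desc (reduced_dm n X \<psi>) @ replicate (2 ^ card Y) 0 =
    spec_desc (reduced_dm n Y \<psi>) @ replicate (2 ^ card X) 0"
proof -
  let ?x = "2 ^ card X :: nat" and ?y = "2 ^ card Y :: nat"
  have YX: "{0..<n} - Y = X" using X by (auto simp: Y_def)
  define M where "M = mat ?x ?y (\<lambda>(a, c). \<psi> $ (embed_idx X a + embed_idx Y c))"
  have M: "M \<in> carrier_mat ?x ?y" by (simp add: M_def)
  note Ma = mat_adjoint_carrier[OF M]
  have M_index: "M $$ (a, c) = \<psi> $ (embed_idx X a + embed_idx Y c)" if "a < ?x" "c < ?y" for a c
    using that by (simp add: M_def)
  have "reduced_dm n X \<psi> = M * mat_adjoint M"
  proof (rule eq_matI)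
    fix a b assume "a < dim_row (M * mat_adjoint M)" "b < dim_col (M * mat_adjoint M)"
    then have ab: "a < ?x" "b < ?x" using M Ma by auto
    show "reduced_dm n X \<psi> $$ (a, b) = (M * mat_adjoint M) $$ (a, b)"
      unfolding index_mult_mat_sum[OF M Ma ab]
      using ab by (auto simp: index_mat_adjoint[OF M] M_index reduced_dm_def Y_def[symmetric])
  qed (use M Ma in \<open>auto simp: reduced_dm_def\<close>)
  moreover have "reduced_dm n Y \<psi> = transpose_mat (mat_adjoint M * M)"
  proof (rule eq_matI)
    fix a b assume "a < dim_row (transpose_mat (mat_adjoint M * M))" "b < dim_col (transpose_mat (mat_adjoint M * M))"
    then have ab: "a < ?y" "b < ?y" using M Ma by auto
    then have "transpose_mat (mat_adjoint M * M) $$ (a, b) = (mat_adjoint M * M) $$ (b, a)"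
      using M Ma by simp
    also have "\<dots> = (\<Sum>c<?x. \<psi> $ (embed_idx X c + embed_idx Y a) * cnj (\<psi> $ (embed_idx X c + embed_idx Y b)))"
      unfolding index_mult_mat_sum[OF Ma M ab(2,1)]
      using ab by (auto simp: index_mat_adjoint[OF M] M_index mult.commute)
    also have "\<dots> = reduced_dm n Y \<psi> $$ (a, b)"
      using ab by (simp add: reduced_dm_def YX add.commute)
    finally show "reduced_dm n Y \<psi> $$ (a, b) = transpose_mat (mat_adjoint M * M) $$ (a, b)" ..
  qed (use M Ma in \<open>auto simp: reduced_dm_def\<close>)
  \<comment> \<open>For this square matrix, transposition leaves the characteristic polynomial
    unchanged.\<close>
  moreover have "mat_adjoint M * M \<in> carrier_mat ?y ?y" using M Ma by simp
  ultimately have "proots (char_poly (reduced_dm n X \<psi>)) + replicate_mset ?y 0 =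
      proots (char_poly (reduced_dm n Y \<psi>)) + replicate_mset ?x 0"
    using proots_char_poly_mult_commute[OF M Ma] by simp
  then have "image_mset complex_of_real (mset (spec_desc (reduced_dm n X \<psi>) @ replicate ?y 0)) =
      image_mset complex_of_real (mset (spec_desc (reduced_dm n Y \<psi>) @ replicate ?x 0))"
    unfolding mset_append image_mset_union mset_spec_desc[OF reduced_dm_herm] by simp
  then have ms: "mset (spec_desc (reduced_dm n X \<psi>) @ replicate ?y 0) = mset (spec_desc (reduced_dm n Y \<psi>) @ replicate ?x 0)"
    by (rule image_mset_of_real_cancel)
  have sorted: "sorted_wrt (\<ge>) (spec_desc (reduced_dm n Z \<psi>) @ replicate k 0)" for Z k
  proof -
    have "\<forall>x\<in>set (spec_desc (reduced_dm n Z \<psi>)). 0 \<le> x"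
      using spec_desc_reduced_dm_nonneg[of _ Z n \<psi>] spec_desc_char_poly(1)[OF reduced_dm_herm, of n Z \<psi>]
      by (auto simp: in_set_conv_nth)
    moreover have "sorted_wrt (\<ge>) (replicate k (0 :: real))" by (induction k) auto
    ultimately show ?thesis
      using spec_desc_char_poly(2)[OF reduced_dm_herm, of n Z \<psi>] by (auto simp: sorted_wrt_append)
  qed
  show ?thesis by (rule sorted_desc_unique[OF sorted sorted ms])
qed

text \<open>The two spectra agree below the smaller dimension, and the longer one vanishes from
  there on. So both passive energies reduce to sums over the same eigenvalues.\<close>

lemma passive_energy_pair:
  fixes n :: nat
  assumes X: "X \<subseteq> {0..<n}"
  defines "Y \<equiv> {0..<n} - X"
  shows "passive_energy n eps X \<psi> + passive_energy n eps Y \<psi> =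
    (\<Sum>j<min (2 ^ card X) (2 ^ card Y). spec_desc (reduced_dm n X \<psi>) ! j * (eps X j + eps Y j))"
    and "\<And>j. j < 2 ^ card X \<Longrightarrow> 2 ^ card Y \<le> j \<Longrightarrow> spec_desc (reduced_dm n X \<psi>) ! j = 0"
proof -
  let ?x = "2 ^ card X :: nat" and ?y = "2 ^ card Y :: nat"
  let ?l = "spec_desc (reduced_dm n X \<psi>)" and ?m = "spec_desc (reduced_dm n Y \<psi>)"
  have len: "length ?l = ?x" "length ?m = ?y"
    using spec_desc_char_poly(1)[OF reduced_dm_herm] by auto
  have nth: "(?l @ replicate ?y 0) ! j = (?m @ replicate ?x 0) ! j" for j
    using reduced_dm_schmidt[OF X] by (simp add: Y_def)
  have eq: "?l ! j = ?m ! j" if "j < ?x" "j < ?y" for j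
    using nth[of j] that len by (simp add: nth_append)
  have l0: "?l ! j = 0" if "j < ?x" "?y \<le> j" for j
    using nth[of j] that len by (simp add: nth_append)
  have m0: "?m ! j = 0" if "j < ?y" "?x \<le> j" for j
    using nth[of j] that len by (simp add: nth_append)
  have "passive_energy n eps X \<psi> = (\<Sum>j<min ?x ?y. ?l ! j * eps X j)"
    unfolding passive_energy_def by (rule sum.mono_neutral_right) (auto simp: l0)
  moreover have "passive_energy n eps Y \<psi> = (\<Sum>j<min ?x ?y. ?l ! j * eps Y j)"
    unfolding passive_energy_def by (rule sum.mono_neutral_cong_right) (auto simp: m0 eq)
  ultimately show "passive_energy n eps X \<psi> + passive_energy n eps Y \<psi> =
    (\<Sum>j<min ?x ?y. ?l ! j * (eps X j + eps Y j))"
    by (simp add: sum.distrib ring_distribs)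
  show "\<And>j. j < ?x \<Longrightarrow> ?y \<le> j \<Longrightarrow> ?l ! j = 0" by (rule l0)
qed

section \<open>Abel summation and majorization\<close>

lemma abel_summation:
  fixes d g :: "nat \<Rightarrow> real"
  shows "(\<Sum>j<Suc r. d j * g j) = sum d {..<Suc r} * g r - (\<Sum>k<r. sum d {..<Suc k} * (g (Suc k) - g k))"
  by (induction r) (simp_all add: algebra_simps)

text \<open>The boundary term of Abel summation carries the factor \<open>sum d {..<r} = 0\<close>;
  for \<open>r = 0\<close> both sums are empty.\<close>

lemma abel_summation_zero_sum:
  fixes d g :: "nat \<Rightarrow> real"
  assumes "sum d {..<r} = 0"
  shows "(\<Sum>j<r. d j * g j) = - (\<Sum>k<r - 1. sum d {..<Suc k} * (g (Suc k) - g k))"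
  using assms abel_summation[of d g "r - 1"] by (cases r) auto

lemma desc_sorted:
  assumes "sorted_wrt (\<ge>) l"
  shows "desc l = l"
proof -
  have "sorted (rev l)" using assms by (simp add: sorted_wrt_rev)
  then have "sort l = rev l" by (intro properties_for_sort) auto
  then show ?thesis by (simp add: desc_def)
qed

lemma sum_list_take_eq_sum: "k \<le> length l \<Longrightarrow> sum_list (take k l) = (\<Sum>i<k. l ! i :: real)"
  by (simp add: sum_list_sum_nth lessThan_atLeast0 min_def)

text \<open>On sorted lists of equal length padding and sorting do nothing. The definition covers
  \<open>1 \<le> k \<le> N - 1\<close>; the case \<open>k = N\<close> comes from the equality of the
  totals.\<close>

lemma majorized_partial_sums:
  assumes "majorized p q" "sorted_wrt (\<ge>) p" "sorted_wrt (\<ge>) q" "length p = N" "length q = N" "k \<le> N"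
  shows "(\<Sum>i<k. p ! i) \<le> (\<Sum>i<k. q ! i)"
proof -
  consider "k = 0" | "k = N" | "1 \<le> k" "k \<le> N - 1" using assms(6) by linarith
  then show ?thesis
  proof cases
    case 2
    then show ?thesis using assms sum_list_take_eq_sum[of k p] sum_list_take_eq_sum[of k q]
      by (simp add: majorized_def Let_def)
  next
    case 3
    then have "sum_list (take k p) \<le> sum_list (take k q)"
      using assms by (simp add: majorized_def Let_def pad_def desc_sorted)
    then show ?thesis using assms(4-6) by (simp add: sum_list_take_eq_sum)
  qed simp
qed

section \<open>The contribution of a single bipartition\<close>

definition pair_level :: "nat \<Rightarrow> (nat set \<Rightarrow> nat \<Rightarrow> real) \<Rightarrow> nat set \<Rightarrow> nat \<Rightarrow> real" where
  "pair_level n eps X j = eps X j + eps ({0..<n} - X) j"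

lemma pair_level_0:
  assumes "hamiltonian_levels n eps" "X \<subseteq> {0..<n}"
  shows "pair_level n eps X 0 = 0"
  using assms by (simp add: hamiltonian_levels_def pair_level_def)

text \<open>The levels of each side are ordered only up to its own dimension, whence the bound by
  the smaller of the two.\<close>

lemma pair_level_mono:
  assumes ham: "hamiltonian_levels n eps" and X: "X \<subseteq> {0..<n}"
    and k: "Suc k < min (2 ^ card X) (2 ^ card ({0..<n} - X))"
  shows "pair_level n eps X k \<le> pair_level n eps X (Suc k)"
proof -
  have "eps Z k \<le> eps Z (Suc k)" if "Z \<subseteq> {0..<n}" "Suc k < 2 ^ card Z" for Z
    using ham that unfolding hamiltonian_levels_def by (meson le_SucI order_refl)
  then show ?thesis unfolding pair_level_def using X k by (intro add_mono) auto
qed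

lemma pair_level_le_eps_max:
  assumes "finite s" "X \<subseteq> s" "j < min (2 ^ card X) (2 ^ card ({0..<n} - X))"
  shows "pair_level n eps X j \<le> eps_max n eps s"
proof -
  have "pair_level n eps X j \<in> (\<lambda>j. eps X j + eps ({0..<n} - X) j) ` {..<min (2 ^ card X) (2 ^ card ({0..<n} - X))}"
    unfolding pair_level_def using assms(3) by (intro imageI) simp
  then show ?thesis
    unfolding eps_max_def using assms(1,2) by (intro Max_ge finite_UN_I UN_I[of X]) simp_all
qed

lemma Delta_diff:
  fixes n :: nat
  assumes X: "X \<subseteq> {0..<n}" and \<psi>: "qstate n \<psi>" and \<phi>: "qstate n \<phi>"
    and proper: "X \<noteq> {}" "X \<noteq> {0..<n}"
  defines "p \<chi> k \<equiv> \<Sum>j<k. spec_desc (reduced_dm n X \<chi>) ! j"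
  shows "Delta n eps X \<psi> - Delta n eps X \<phi> =
    - (\<Sum>k<min (2 ^ card X) (2 ^ card ({0..<n} - X)) - 1.
        (p \<psi> (Suc k) - p \<phi> (Suc k)) * (pair_level n eps X (Suc k) - pair_level n eps X k))"
proof -
  let ?r = "min (2 ^ card X) (2 ^ card ({0..<n} - X)) :: nat"
  define d where "d j = spec_desc (reduced_dm n X \<psi>) ! j - spec_desc (reduced_dm n X \<phi>) ! j" for j
  have d: "sum d {..<k} = p \<psi> k - p \<phi> k" for k
    by (simp add: d_def p_def sum_subtractf)
  \<comment> \<open>The entries from \<open>?r\<close> on vanish, so the truncated sum is already
    the full trace; hence the differences \<open>d\<close> sum to zero and Abel summation has no
    boundary term.\<close>
  have p1: "p \<chi> ?r = 1" if "qstate n \<chi>" for \<chi>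
  proof -
    have "p \<chi> ?r = (\<Sum>j<2 ^ card X. spec_desc (reduced_dm n X \<chi>) ! j)"
      unfolding p_def by (rule sum.mono_neutral_left) (auto simp: passive_energy_pair(2)[OF X])
    then show ?thesis using spec_desc_reduced_dm_sum[OF X that] by simp
  qed
  have "sum d {..<?r} = 0" unfolding d p1[OF \<psi>] p1[OF \<phi>] by simp
  from abel_summation_zero_sum[OF this, of "pair_level n eps X"]
  have "(\<Sum>j<?r. d j * pair_level n eps X j) =
      - (\<Sum>k<?r - 1. (p \<psi> (Suc k) - p \<phi> (Suc k)) * (pair_level n eps X (Suc k) - pair_level n eps X k))"
    unfolding d .
  moreover have "Delta n eps X \<psi> - Delta n eps X \<phi> = (\<Sum>j<?r. d j * pair_level n eps X j)"
    using proper by (simp add: Delta_def passive_energy_pair(1)[OF X] d_def pair_level_def left_diff_distrib sum_subtractf)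
  ultimately show ?thesis by simp
qed

text \<open>In the Abel form of \<open>Delta_diff\<close> every summand is a nonpositive difference
  of partial sums times a nonnegative level gap, and the sum enters with a minus sign.\<close>

lemma Delta_majorized_le:
  fixes n :: nat
  assumes X: "X \<subseteq> {0..<n}" and \<psi>: "qstate n \<psi>" and \<phi>: "qstate n \<phi>" and ham: "hamiltonian_levels n eps"
    and maj: "majorized (spec_desc (reduced_dm n X \<psi>)) (spec_desc (reduced_dm n X \<phi>))"
  shows "Delta n eps X \<phi> \<le> Delta n eps X \<psi>"
proof (cases "X = {} \<or> X = {0..<n}")
  case False
  let ?r = "min (2 ^ card X) (2 ^ card ({0..<n} - X)) :: nat"
  let ?p = "\<lambda>\<chi> k. \<Sum>j<k. spec_desc (reduced_dm n X \<chi>) ! j"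
  have "(?p \<psi> (Suc k) - ?p \<phi> (Suc k)) * (pair_level n eps X (Suc k) - pair_level n eps X k) \<le> 0"
    if k: "k < ?r - 1" for k
  proof (rule mult_nonpos_nonneg)
    have "Suc k \<le> 2 ^ card X" using k by simp
    from majorized_partial_sums[OF maj spec_desc_char_poly(2,2,1,1)[OF reduced_dm_herm] this]
    show "?p \<psi> (Suc k) - ?p \<phi> (Suc k) \<le> 0" by simp
    have "Suc k < ?r" using k by linarith
    from pair_level_mono[OF ham X this] show "0 \<le> pair_level n eps X (Suc k) - pair_level n eps X k"
      by simp
  qed
  then have "(\<Sum>k<?r - 1. (?p \<psi> (Suc k) - ?p \<phi> (Suc k)) * (pair_level n eps X (Suc k) - pair_level n eps X k)) \<le> 0"
    by (intro sum_nonpos) auto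
  then show ?thesis using Delta_diff[OF X \<psi> \<phi>, of eps] False by linarith
qed (auto simp: Delta_def)

text \<open>In the same Abel form every difference of partial sums is at most the trace norm in
  absolute value, and the nonnegative gaps telescope to the top level, which \<open>eps_max\<close>
  bounds.\<close>

lemma Delta_trace_norm_le:
  fixes n :: nat
  assumes s: "s \<subseteq> {0..<n}" and \<psi>: "qstate n \<psi>" and \<phi>: "qstate n \<phi>" and ham: "hamiltonian_levels n eps"
    and Xs: "X \<subseteq> s" and pos: "0 < eps_max n eps s"
  shows "\<bar>Delta n eps X \<psi> - Delta n eps X \<phi>\<bar> \<le> trace_norm (proj \<psi> - proj \<phi>) * eps_max n eps s"
proof -
  let ?T = "trace_norm (proj \<psi> - proj \<phi>)"
  have X: "X \<subseteq> {0..<n}" using s Xs by simp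
  have dims: "dim_vec \<psi> = 2 ^ n" "dim_vec \<phi> = 2 ^ n" using \<psi> \<phi> by (auto simp: qstate_def)
  \<comment> \<open>This settles the trivial cuts, where \<open>Delta\<close> is 0 by definition,
    and serves the final multiplication in the proper case.\<close>
  have T: "0 \<le> ?T" using trace_norm_hermitian[OF proj_diff_hermitian[OF dims]] by (simp add: sum_nonneg)
  show ?thesis
  proof (cases "X = {} \<or> X = {0..<n}")
    case True
    then show ?thesis using T pos by (auto simp: Delta_def)
  next
    case False
    let ?r = "min (2 ^ card X) (2 ^ card ({0..<n} - X)) :: nat"
    let ?p = "\<lambda>\<chi> k. \<Sum>j<k. spec_desc (reduced_dm n X \<chi>) ! j"
    let ?g = "pair_level n eps X"
    have "0 < ?r" by simp
    then have r: "?r - 1 < ?r" by linarith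
    have fin: "finite s" using s by (rule finite_subset) simp
    have "\<bar>Delta n eps X \<psi> - Delta n eps X \<phi>\<bar> = \<bar>\<Sum>k<?r - 1. (?p \<psi> (Suc k) - ?p \<phi> (Suc k)) * (?g (Suc k) - ?g k)\<bar>"
      using Delta_diff[OF X \<psi> \<phi>, of eps] False by linarith
    also have "\<dots> \<le> (\<Sum>k<?r - 1. \<bar>(?p \<psi> (Suc k) - ?p \<phi> (Suc k)) * (?g (Suc k) - ?g k)\<bar>)"
      by (rule sum_abs)
    also have "\<dots> \<le> (\<Sum>k<?r - 1. ?T * (?g (Suc k) - ?g k))"
    proof (rule sum_mono)
      fix k assume "k \<in> {..<?r - 1}"
      then have "k < ?r - 1" by simp
      then have k: "Suc k < ?r" by linarith
      then have "Suc k \<le> 2 ^ card X" by linarith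
      from spec_desc_top_sum_le[OF X dims this] have "\<bar>?p \<psi> (Suc k) - ?p \<phi> (Suc k)\<bar> \<le> ?T" .
      moreover have "\<bar>?g (Suc k) - ?g k\<bar> = ?g (Suc k) - ?g k" using pair_level_mono[OF ham X k] by simp
      ultimately show "\<bar>(?p \<psi> (Suc k) - ?p \<phi> (Suc k)) * (?g (Suc k) - ?g k)\<bar> \<le> ?T * (?g (Suc k) - ?g k)"
        unfolding abs_mult by (metis abs_ge_zero mult_right_mono)
    qed
    also have "\<dots> = ?T * ?g (?r - 1)"
      unfolding sum_distrib_left[symmetric] sum_lessThan_telescope pair_level_0[OF ham X] by simp
    also have "\<dots> \<le> ?T * eps_max n eps s"
      by (rule mult_left_mono[OF pair_level_le_eps_max[OF fin Xs r] T])
    finally show ?thesis .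
  qed
qed

theorem theorem3:
  fixes n :: nat and s :: "nat set" and \<psi> \<phi> :: "complex vec"
    and eps :: "nat set \<Rightarrow> nat \<Rightarrow> real"
  assumes "s \<subseteq> {0..<n}"
    and "qstate n \<psi>" and "qstate n \<phi>"
    and "hamiltonian_levels n eps"
    and "eps_max n eps s > 0"
  shows "(\<forall>\<epsilon>>0. trace_dist \<psi> \<phi> \<le> \<epsilon> / (2 * eps_max n eps s) \<longrightarrow>
            \<bar>ME n eps s \<psi> - ME n eps s \<phi>\<bar> \<le> \<epsilon>)
       \<and> ((\<forall>X\<in>Pow s. majorized (spec_desc (reduced_dm n X \<psi>)) (spec_desc (reduced_dm n X \<phi>)))
            \<longrightarrow> ME n eps s \<psi> \<ge> ME n eps s \<phi>)"
proof (intro conjI allI impI)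
  fix \<epsilon> :: real
  assume "trace_dist \<psi> \<phi> \<le> \<epsilon> / (2 * eps_max n eps s)"
  \<comment> \<open>\<open>trace_dist\<close> is half of the trace norm, so the two factors of 2
    cancel.\<close>
  then have T: "trace_norm (proj \<psi> - proj \<phi>) * eps_max n eps s \<le> \<epsilon>"
    using assms(5) by (simp add: trace_dist_def field_simps)
  have fin: "finite s" using assms(1) by (rule finite_subset) simp
  have "\<bar>\<Sum>X\<in>Pow s. Delta n eps X \<psi> - Delta n eps X \<phi>\<bar> \<le> (\<Sum>X\<in>Pow s. \<bar>Delta n eps X \<psi> - Delta n eps X \<phi>\<bar>)"
    by (rule sum_abs)
  also have "\<dots> \<le> (\<Sum>X\<in>Pow s. \<epsilon>)"
    by (intro sum_mono order_trans[OF Delta_trace_norm_le[OF assms(1-4) _ assms(5)] T]) simp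
  \<comment> \<open>The number of subsets of \<open>s\<close> cancels the normalisation in
    \<open>ME\<close>.\<close>
  also have "\<dots> = 2 ^ card s * \<epsilon>" using fin by (simp add: card_Pow)
  finally show "\<bar>ME n eps s \<psi> - ME n eps s \<phi>\<bar> \<le> \<epsilon>"
    by (simp add: ME_def diff_divide_distrib[symmetric] sum_subtractf abs_divide pos_divide_le_eq mult.commute)
next
  assume "\<forall>X\<in>Pow s. majorized (spec_desc (reduced_dm n X \<psi>)) (spec_desc (reduced_dm n X \<phi>))"
  then have "(\<Sum>X\<in>Pow s. Delta n eps X \<phi>) \<le> (\<Sum>X\<in>Pow s. Delta n eps X \<psi>)"
    using Delta_majorized_le[OF _ assms(2-4)] assms(1) by (intro sum_mono) blast
  then show "ME n eps s \<psi> \<ge> ME n eps s \<phi>" by (simp add: ME_def divide_right_mono)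
qed

end
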